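(* Let $s\ge1$, $0<R<1/2$, $M>0$, $1\le p\le\infty$, $1\le q\le\infty$. There exist constants $C_1,C_2$ (independent of $h$, $u$ and $\eta$) such that for every integer $L$ with $h=1/L<R$, $n=L^2=h^{-2}$, every $u\in\mathcal{F}_{s,R,M}$ and every noise vector $\eta\in\mathbb{R}^n$, the global nonlinear reconstruction $\tilde u$ built from the noisy cell averages $z=(a_T(u))_{T\in\mathcal{T}_h}+\eta\in\mathbb{R}^n$ (defined in the context) satisfies $$\|u-\tilde u\|_{L^q(D)}\le C_1\,n^{-\frac{\min(1,s/2)}{q}}+C_2\,n^{-\frac1{pq}}\,\|\eta\|_p^{\frac1q}.$$
   Context: $D=[0,1]^2$. For an integer $L$ and $h=1/L$, $\mathcal{T}_h=\{T_{i,j}=[(i-1)h,ih]\times[(j-1)h,jh] : i,j=1,\dots,L\}$. $a_T(u)=\frac1{|T|}\int_Tu$, $\|\cdot\|_p$ is the $\ell^p$ norm. Conventions: $1/\infty=0$, $t^0=1$. Reconstruction: for an inner cell $T=T_{i,j}$, $1<i,j<L$, let $\bar x=((i-\frac12)h,(j-\frac12)h)$ be its center, $S=[(i-2)h,(i+1)h]\times[(j-2)h,(j+1)h]$ its $3\times3$ stencil, $V_2=\{\chi_{\vec n\cdot(x-\bar x)\ge c}:\vec n\in\mathbb{S}^1,\ c\in\mathbb{R}\}$ the set of indicator functions of half-planes, and $$\tilde u_T\in\operatorname{argmin}_{v\in V_2}\sum_{T'\subset S}|z_{T'}-a_{T'}(v)|,$$ where $T'$ ranges over the 9 grid cells contained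 in $S$ and $z_{T'}$ is the entry of $z$ for cell $T'$. The function $\tilde u$ is defined by $\tilde u|_T=\tilde u_T|_T$ on each inner cell $T=T_{i,j}$, $1<i,j<L$, and $\tilde u|_T=0$ on the boundary cells $T_{i,j}$ with $i$ or $j$ in $\{1,L\}$. Class $\mathcal{F}_{s,R,M}$: it consists of all characteristic functions $\chi_\Omega$ of domains $\Omega\subset[R,1-R]^2\subset D$ with the following property: for all $x\in D$ there exist an orthonormal system $(e_1,e_2)$ of $\mathbb{R}^2$ and a function $\psi\in\mathcal{C}^s([-R,R])$ with $\|\psi\|_{\mathcal{C}^s}\le M$ such that, for any $y=x+z_1e_1+z_2e_2$ with $|z_1|,|z_2|\le R$, one has $y\in\Omega\iff z_2\le\psi(z_1)$. Hölder norm: with $k_s:=\lceil s\rceil-1$ (equal to $\lfloor s\rfloor$ for non-integer $s$ and to $s-1$ for integer $s$), $$\|\psi\|_{\mathcal{C}^s}=\sup_{0\le k\le k_s}\|\psi^{(k)}\|_{L^\infty([-R,R])}+\sup_{a\ne b\in[-R,R]}\frac{|\psi^{(k_s)}(a)-\psi^{(k_s)}(b)|}{|a-b|^{s-k_s}}.$$ So for integer $s$, $\mathcal{C}^s$ denotes functions with Lipschitz derivatives up to order $s-1$. *)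

theory Defs
  imports "HOL-Analysis.Analysis" "HOL-Probability.Essential_Supremum"
begin

text \<open>Throughout, exponents in \<open>[1, \<infinity>]\<close> are elements of \<open>ennreal\<close>. Division there
  satisfies \<open>1 / \<infinity> = 0\<close>, so \<open>recip p\<close> is the real number \<open>1/p\<close> with the usual convention.\<close>

definition recip :: "ennreal \<Rightarrow> real" where
  "recip p = enn2real (1 / p)"

text \<open>Power with \<open>t\<^sup>0 = 1\<close> also for \<open>t = 0\<close>, whereas \<open>0 powr 0 = 0\<close>.\<close>

definition rpow :: "real \<Rightarrow> real \<Rightarrow> real" where
  "rpow t a = (if a = 0 then 1 else t powr a)"

text \<open>The value is \<open>\<infinity>\<close> for non-measurable functions, in accordance with \<^const>\<open>esssup\<close>.\<close>

definition Lp_norm :: "'a measure \<Rightarrow> ennreal \<Rightarrow> ('a \<Rightarrow> real) \<Rightarrow> ennreal" where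
  "Lp_norm M p f =
     (if f \<notin> borel_measurable M then \<infinity>
      else if p = \<infinity> then esssup M (\<lambda>x. ennreal \<bar>f x\<bar>)
      else let I = (\<integral>\<^sup>+ x. ennreal (\<bar>f x\<bar> powr enn2real p) \<partial>M)
           in if I = \<infinity> then \<infinity> else ennreal (enn2real I powr recip p))"

text \<open>The norm of \<open>\<ell>\<^sup>p(I)\<close> for a finite nonempty index set \<open>I\<close>.\<close>

definition lp_norm :: "'i set \<Rightarrow> ennreal \<Rightarrow> ('i \<Rightarrow> real) \<Rightarrow> real" where
  "lp_norm I p x =
     (if p = \<infinity> then Max ((\<lambda>i. \<bar>x i\<bar>) ` I)
      else (\<Sum>i\<in>I. \<bar>x i\<bar> powr enn2real p) powr recip p)"


section \<open>Grid, cell averages and reconstruction\<close>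

abbreviation rect :: "real \<Rightarrow> real \<Rightarrow> real \<Rightarrow> real \<Rightarrow> (real^2) set" where
  "rect a b c d \<equiv> cbox (vector [a, c]) (vector [b, d])"

definition unit_square :: "(real^2) set" where
  "unit_square = rect 0 1 0 1"

definition grid :: "nat \<Rightarrow> (nat \<times> nat) set" where
  "grid L = {1..L} \<times> {1..L}"

definition inner_grid :: "nat \<Rightarrow> (nat \<times> nat) set" where
  "inner_grid L = {1<..<L} \<times> {1<..<L}"

fun cell :: "real \<Rightarrow> nat \<times> nat \<Rightarrow> (real^2) set" where
  "cell h (i, j) = rect ((real i - 1) * h) (real i * h) ((real j - 1) * h) (real j * h)"

fun cell_center :: "real \<Rightarrow> nat \<times> nat \<Rightarrow> real^2" where
  "cell_center h (i, j) = vector [(real i - 1/2) * h, (real j - 1/2) * h]"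

fun stencil :: "real \<Rightarrow> nat \<times> nat \<Rightarrow> (real^2) set" where
  "stencil h (i, j) =
     rect ((real i - 2) * h) ((real i + 1) * h) ((real j - 2) * h) ((real j + 1) * h)"

definition average :: "(real^2) set \<Rightarrow> (real^2 \<Rightarrow> real) \<Rightarrow> real" where
  "average T u = set_lebesgue_integral lebesgue T u / measure lebesgue T"

definition half_planes :: "real^2 \<Rightarrow> (real^2 \<Rightarrow> real) set" where
  "half_planes xbar = {indicator {x. n \<bullet> (x - xbar) \<ge> c} | n c. norm n = 1}"

definition local_fit :: "nat \<Rightarrow> (nat \<times> nat \<Rightarrow> real) \<Rightarrow> nat \<times> nat \<Rightarrow> (real^2 \<Rightarrow> real) \<Rightarrow> bool" where
  "local_fit L z ij v \<longleftrightarrow>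
     (let h = 1 / real L in
      is_arg_min
        (\<lambda>w. \<Sum>kl \<in> {kl \<in> grid L. cell h kl \<subseteq> stencil h ij}. \<bar>z kl - average (cell h kl) w\<bar>)
        (\<lambda>w. w \<in> half_planes (cell_center h ij)) v)"

text \<open>Minimizers need not be unique, hence a relation: \<open>ut\<close> is a reconstruction from \<open>z\<close> for some
  choice of minimizers \<open>w\<close>. Since the closed cells overlap in edges, the values of \<open>ut\<close> are
  prescribed in the interiors of the cells only, i.e. up to a null set.\<close>

definition is_reconstruction :: "nat \<Rightarrow> (nat \<times> nat \<Rightarrow> real) \<Rightarrow> (real^2 \<Rightarrow> real) \<Rightarrow> bool" where
  "is_reconstruction L z ut \<longleftrightarrow>
     (\<exists>w. (\<forall>ij \<in> inner_grid L. local_fit L z ij (w ij) \<and>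
             (\<forall>x \<in> interior (cell (1 / real L) ij). ut x = w ij x)) \<and>
          (\<forall>ij \<in> grid L - inner_grid L.
             \<forall>x \<in> interior (cell (1 / real L) ij). ut x = 0))"


section \<open>Hoelder spaces on an interval and the class of domains\<close>

text \<open>Iterated derivative within a set (one-sided at the end points of an interval).\<close>

primrec nth_deriv_within :: "real set \<Rightarrow> nat \<Rightarrow> (real \<Rightarrow> real) \<Rightarrow> real \<Rightarrow> real" where
  "nth_deriv_within I 0 f = f"
| "nth_deriv_within I (Suc k) f =
     (\<lambda>x. vector_derivative (nth_deriv_within I k f) (at x within I))"

definition holder_order :: "real \<Rightarrow> nat" where
  "holder_order s = nat (\<lceil>s\<rceil> - 1)"

definition holder_norm :: "real \<Rightarrow> real set \<Rightarrow> (real \<Rightarrow> real) \<Rightarrow> ennreal" where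
  "holder_norm s I f =
     (let k\<^sub>s = holder_order s; g = nth_deriv_within I k\<^sub>s f in
      (SUP k\<in>{0..k\<^sub>s}. Lp_norm (lebesgue_on I) \<infinity> (nth_deriv_within I k f)) +
      (SUP (a, b)\<in>{(a, b). a \<in> I \<and> b \<in> I \<and> a \<noteq> b}.
         ennreal (\<bar>g a - g b\<bar> / \<bar>a - b\<bar> powr (s - real k\<^sub>s))))"

text \<open>Finiteness of the norm makes the derivative of top order continuous.\<close>

definition holder_space :: "real \<Rightarrow> real set \<Rightarrow> (real \<Rightarrow> real) set" where
  "holder_space s I =
     {f. (\<forall>k < holder_order s. \<forall>x\<in>I. nth_deriv_within I k f differentiable (at x within I)) \<and>
         holder_norm s I f < \<infinity>}"

definition smooth_class :: "real \<Rightarrow> real \<Rightarrow> real \<Rightarrow> (real^2 \<Rightarrow> real) set" where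
  "smooth_class s R M =
     {indicator \<Omega> | \<Omega>.
        \<Omega> \<subseteq> rect R (1 - R) R (1 - R) \<and>
        (\<forall>x \<in> unit_square. \<exists>e\<^sub>1 e\<^sub>2 \<psi>.
           norm e\<^sub>1 = 1 \<and> norm e\<^sub>2 = 1 \<and> e\<^sub>1 \<bullet> e\<^sub>2 = 0 \<and>
           \<psi> \<in> holder_space s {-R..R} \<and> holder_norm s {-R..R} \<psi> \<le> ennreal M \<and>
           (\<forall>z\<^sub>1 z\<^sub>2. \<bar>z\<^sub>1\<bar> \<le> R \<and> \<bar>z\<^sub>2\<bar> \<le> R \<longrightarrow>
              (x + z\<^sub>1 *\<^sub>R e\<^sub>1 + z\<^sub>2 *\<^sub>R e\<^sub>2 \<in> \<Omega> \<longleftrightarrow> z\<^sub>2 \<le> \<psi> z\<^sub>1)))}"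

end

theory Submission
  imports Defs
begin

text \<open>
  Write \<open>h = 1/L\<close>. Almost everywhere the difference of \<open>u = \<chi>\<^sub>\<Omega>\<close> and its reconstruction is
  \<open>-1\<close>, \<open>0\<close> or \<open>1\<close>, so its \<open>L\<^sup>q\<close> norm is the power \<open>1/q\<close> of the area of the set where the two
  functions differ (\<open>Lp_norm_sign_function\<close>). Since \<open>(a + b)\<^sup>r \<le> a\<^sup>r + b\<^sup>r\<close> for \<open>0 \<le> r \<le> 1\<close>, it
  suffices to bound this area by \<open>C h\<^sup>\<alpha> + 36 h\<^sup>2 \<Sum> \<bar>\<eta>\<bar>\<close> with \<open>\<alpha> = min s 2\<close>; Hoelder's inequality for
  finite sums then turns the \<open>\<ell>\<^sup>1\<close> norm of the noise into its \<open>\<ell>\<^sup>p\<close> norm.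

  Two facts control the area on a single inner cell. The first is stability
  (\<open>half_plane_stability\<close>): on the central cell of a \<open>3 \<times> 3\<close> stencil the symmetric difference of
  two half-planes is at most twice the \<open>\<ell>\<^sup>1\<close> distance of their masses on the nine cells, whatever the
  two half-planes are. The two halves of the symmetric difference are opposite wedges. If only one
  of them meets the central cell there is nothing to prove; otherwise translating a wedge, or
  dilating it from its apex, moves its part in the central cell into cells that the opposite wedge
  misses, so that no cancellation takes place there. Together with the minimality of the fitted
  half-plane this bounds the error on the cell by the local noise and by the distance on the stencil
  between \<open>\<Omega>\<close> and any competing half-plane (\<open>local_fit_error\<close>).

  The second fact is approximation (\<open>subgraph_local_approximation\<close>): in a chart, \<open>\<Omega>\<close> is the subgraph
  of a function that deviates from an affine one by \<open>O(h\<^sup>\<alpha>)\<close> on the stencil, so some half-plane misses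
  \<open>\<Omega>\<close> there by an area \<open>O(h\<^sup>1\<^sup>+\<^sup>\<alpha>)\<close>; if the boundary of \<open>\<Omega>\<close> does not cross the stencil, a half-plane
  that contains or avoids the stencil makes no error at all. A cell whose stencil is crossed by the
  boundary lies in a neighbourhood \<open>U\<close> of the graph, of area \<open>O(h)\<close>. In place of counting these cells,
  the error is written as \<open>O(h\<^sup>\<alpha>\<^sup>-\<^sup>1)\<close> times the area of the intersection of the cell with \<open>U\<close>; the
  sum over all cells is then \<open>O(h\<^sup>\<alpha>)\<close>. A finite net of chart centres, chosen independently of
  \<open>\<Omega>\<close>, makes the constants uniform. On boundary cells both functions vanish because \<open>h < R\<close>.
\<close>

section \<open>Squares and opposite wedges\<close>

text \<open>The square of side \<open>h\<close> centred at \<open>c + h t\<close>. Shifts \<open>t\<close> with entries in \<open>{-1, 0, 1}\<close> yield the nine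
  cells of the stencil around the cell with centre \<open>c\<close>, and \<open>t = 0\<close> with side \<open>3 h\<close> the stencil itself.\<close>

definition square :: "real^2 \<Rightarrow> real \<Rightarrow> real^2 \<Rightarrow> (real^2) set" where
  "square c h t = cbox (\<chi> i. c $ i + (t $ i - 1/2) * h) (\<chi> i. c $ i + (t $ i + 1/2) * h)"

lemma mem_square: "x \<in> square c h t \<longleftrightarrow> (\<forall>i. \<bar>x $ i - c $ i - t $ i * h\<bar> \<le> h / 2)"
proof -
  have "c $ i + (t $ i - 1/2) * h \<le> x $ i \<and> x $ i \<le> c $ i + (t $ i + 1/2) * h
      \<longleftrightarrow> \<bar>x $ i - c $ i - t $ i * h\<bar> \<le> h / 2" for i
    unfolding abs_le_iff distrib_right left_diff_distrib by linarith
  then show ?thesis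
    by (simp add: square_def mem_box_cart)
qed

lemma lmeasurable_square [simp]: "square c h t \<in> lmeasurable"
  by (simp add: square_def)

lemma measure_square:
  assumes "h \<ge> 0"
  shows "measure lebesgue (square c h t) = h\<^sup>2"
proof -
  have "square c h t \<noteq> {}"
    using assms by (auto simp: square_def interval_ne_empty_cart algebra_simps)
  then show ?thesis
    by (simp add: square_def content_cbox_cart algebra_simps power2_eq_square)
qed

definition shifts :: "(real^2) set" where
  "shifts = {t. \<forall>i. t $ i \<in> {-1, 0, 1}}"

lemma finite_shifts: "finite shifts"
proof -
  have "shifts \<subseteq> (\<lambda>(a, b). vector [a, b]) ` ({-1, 0, 1} \<times> {-1, 0, 1})"
  proof
    fix t assume "t \<in> shifts"
    moreover have "t = vector [t $ 1, t $ 2]"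
      by (simp add: vec_eq_iff forall_2)
    ultimately show "t \<in> (\<lambda>(a, b). vector [a, b]) ` ({-1, 0, 1} \<times> {-1, 0, 1})"
      unfolding shifts_def by (intro image_eqI[of _ _ "(t $ 1, t $ 2)"]) (auto simp: mem_Times_iff)
  qed
  then show ?thesis
    by (rule finite_subset) auto
qed

text \<open>For two half-planes \<open>P = {x. c \<le> n \<bullet> x}\<close> and \<open>Q = {x. e \<le> m \<bullet> x}\<close>, the choice \<open>k = -m\<close>, \<open>d = -e\<close>
  makes \<open>P - Q\<close> a wedge and \<open>Q - P\<close> the opposite wedge. With the sign of \<open>m\<close> reversed, adding a
  vector \<open>v\<close> with \<open>n \<bullet> v \<ge> 0\<close> and \<open>k \<bullet> v \<ge> 0\<close> maps a wedge into itself, and subtracting it the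
  opposite wedge.\<close>
definition wedge :: "'a::real_inner \<Rightarrow> 'a \<Rightarrow> real \<Rightarrow> real \<Rightarrow> 'a set" where
  "wedge n k c d = {x. c \<le> n \<bullet> x \<and> d < k \<bullet> x}"

definition opp_wedge :: "'a::real_inner \<Rightarrow> 'a \<Rightarrow> real \<Rightarrow> real \<Rightarrow> 'a set" where
  "opp_wedge n k c d = {x. n \<bullet> x < c \<and> k \<bullet> x \<le> d}"

lemma inner_two:
  fixes n x :: "real^2" and i j :: 2
  assumes "i \<noteq> j"
  shows "n \<bullet> x = n $ i * x $ i + n $ j * x $ j"
  using assms exhaust_2[of i] exhaust_2[of j] by (auto simp: inner_vec_def sum_2)

lemma index_two_cases: "i = a \<or> i = b" if "a \<noteq> b" for a b i :: 2
  using that exhaust_2[of i] exhaust_2[of a] exhaust_2[of b] by auto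

text \<open>A nonnegative combination of \<open>n\<close> and \<open>k\<close> is larger on the wedge than on the opposite wedge. If
  the \<open>j\<close>-th entries have opposite signs, the weights can be chosen so that the combination is
  parallel to the other coordinate axis: an axis-parallel line then separates the two wedges,
  or the combination vanishes and one of them is empty.\<close>
lemma wedge_separation:
  fixes n k x :: "real^2" and i j :: 2 and c d :: real
  assumes ij: "i \<noteq> j" and sgn: "n $ j * k $ j < 0"
  defines "A \<equiv> \<bar>k $ j\<bar> * n $ i + \<bar>n $ j\<bar> * k $ i" and "B \<equiv> \<bar>k $ j\<bar> * c + \<bar>n $ j\<bar> * d"
  shows "x \<in> wedge n k c d \<Longrightarrow> B < A * x $ i"
    and "x \<in> opp_wedge n k c d \<Longrightarrow> A * x $ i < B"
proof -
  have pos: "\<bar>k $ j\<bar> > 0" "\<bar>n $ j\<bar> > 0"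
    using sgn by auto
  have "\<bar>k $ j\<bar> * n $ j + \<bar>n $ j\<bar> * k $ j = 0"
    using sgn by (auto simp: mult_less_0_iff)
  then have eq: "A * x $ i = \<bar>k $ j\<bar> * (n \<bullet> x) + \<bar>n $ j\<bar> * (k \<bullet> x)"
    unfolding A_def inner_two[OF ij] by algebra
  show "B < A * x $ i" if "x \<in> wedge n k c d"
    using that pos unfolding eq B_def wedge_def
    by (intro add_le_less_mono mult_left_mono mult_strict_left_mono) auto
  show "A * x $ i < B" if "x \<in> opp_wedge n k c d"
    using that pos unfolding eq B_def opp_wedge_def
    by (intro add_less_le_mono mult_left_mono mult_strict_left_mono) auto
qed

lemma sets_lebesgue_wedge [measurable]:
  fixes n k :: "real^2"
  shows "wedge n k c d \<in> sets lebesgue" "opp_wedge n k c d \<in> sets lebesgue"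
proof -
  have "wedge n k c d \<in> sets borel" "opp_wedge n k c d \<in> sets borel"
    unfolding wedge_def opp_wedge_def by measurable
  then show "wedge n k c d \<in> sets lebesgue" "opp_wedge n k c d \<in> sets lebesgue"
    by auto
qed

text \<open>Multiplying by the sign \<open>\<sigma>\<close> treats a shift to the right and a shift to the left alike.\<close>
lemma shift_toward:
  fixes p x :: "real^2"
  assumes "p \<in> square b h 0" "x \<in> square b h t" "t $ i = \<sigma>" "\<bar>\<sigma>\<bar> = 1"
  shows "\<sigma> * p $ i \<le> \<sigma> * b $ i + h / 2" "\<sigma> * b $ i + h / 2 \<le> \<sigma> * x $ i"
proof -
  have "\<bar>p $ i - b $ i\<bar> \<le> h / 2" "\<bar>x $ i - b $ i - \<sigma> * h\<bar> \<le> h / 2"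
    using assms by (auto simp: mem_square)
  then show "\<sigma> * p $ i \<le> \<sigma> * b $ i + h / 2" "\<sigma> * b $ i + h / 2 \<le> \<sigma> * x $ i"
    using assms(4) by (auto simp: abs_if split: if_splits)
qed

lemma mult_mono_sgn:
  fixes \<sigma> v a b :: real
  assumes "\<bar>\<sigma>\<bar> = 1" "0 \<le> \<sigma> * v" "\<sigma> * a \<le> \<sigma> * b"
  shows "v * a \<le> v * b"
  using assms by (auto simp: abs_if mult_left_mono mult_left_mono_neg split: if_splits)

section \<open>Stability of half-planes under cell averages\<close>

text \<open>If in each coordinate \<open>n\<close> and \<open>k\<close> have the same sign, the wedge contains, with a point, the
  quadrant that starts at this point in the direction of these signs, hence a whole corner cell of
  the stencil.\<close>
lemma wedge_shift_both:
  fixes n k b :: "real^2"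
  assumes same: "\<And>i. n $ i * k $ i \<ge> 0" and p: "p \<in> wedge n k c d \<inter> square b h 0"
  shows "\<exists>t\<in>shifts. square b h t \<subseteq> wedge n k c d"
proof -
  define t :: "real^2" where "t = (\<chi> i. if n $ i < 0 \<or> k $ i < 0 then -1 else 1)"
  have nn: "t $ i * n $ i \<ge> 0" "t $ i * k $ i \<ge> 0" and abs: "\<bar>t $ i\<bar> = 1" for i
    using same[of i] by (auto simp: t_def zero_le_mult_iff split: if_splits)
  have ge: "v \<bullet> p \<le> v \<bullet> x" if "x \<in> square b h t" "\<And>i. t $ i * v $ i \<ge> 0" for x v
    unfolding inner_vec_def
  proof (rule sum_mono, unfold inner_real_def)
    fix i
    have "t $ i * p $ i \<le> t $ i * x $ i"
      using shift_toward[OF _ that(1) refl abs, of p i] p by auto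
    with abs that(2) show "v $ i * p $ i \<le> v $ i * x $ i"
      by (rule mult_mono_sgn[of "t $ i"])
  qed
  have "t \<in> shifts"
    by (auto simp: shifts_def t_def)
  moreover have "square b h t \<subseteq> wedge n k c d"
    using p ge[of _ n] ge[of _ k] nn by (fastforce simp: wedge_def)
  ultimately show ?thesis by blast
qed

text \<open>If only the \<open>i\<close>-th entries have the same sign, translation along this axis in the direction of
  their sign maps the wedge into itself, and a line orthogonal to the axis separates the two wedges.
  Translation by \<open>h\<close> moves the central part of the wedge into a cell beyond that line.\<close>
lemma wedge_shift_axis:
  fixes n k b :: "real^2" and i j :: 2
  assumes h: "h > 0" and ij: "i \<noteq> j" and same: "n $ i * k $ i \<ge> 0" and diff: "n $ j * k $ j < 0"
    and p: "p \<in> wedge n k c d \<inter> square b h 0"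
  shows "\<exists>t\<in>shifts. opp_wedge n k c d \<inter> square b h t = {} \<and>
    measure lebesgue (wedge n k c d \<inter> square b h 0) \<le> measure lebesgue (wedge n k c d \<inter> square b h t)"
proof -
  define \<sigma> :: real where "\<sigma> = (if n $ i < 0 \<or> k $ i < 0 then -1 else 1)"
  define t :: "real^2" where "t = axis i \<sigma>"
  have nn: "\<sigma> * n $ i \<ge> 0" "\<sigma> * k $ i \<ge> 0" and abs: "\<bar>\<sigma>\<bar> = 1"
    using same by (auto simp: \<sigma>_def zero_le_mult_iff split: if_splits)
  have ti: "t $ i = \<sigma>" and tj: "t $ j = 0"
    using ij by (auto simp: t_def axis_def)
  define A where "A = \<bar>k $ j\<bar> * n $ i + \<bar>n $ j\<bar> * k $ i"
  define B where "B = \<bar>k $ j\<bar> * c + \<bar>n $ j\<bar> * d"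
  note sep = wedge_separation[OF ij diff, where c = c and d = d, folded A_def B_def]
  have "\<sigma> * A \<ge> 0"
    using nn by (auto simp: A_def distrib_left mult.left_commute[of \<sigma>] intro!: add_nonneg_nonneg mult_nonneg_nonneg)
  have "opp_wedge n k c d \<inter> square b h t = {}"
  proof (rule equals0I)
    fix x assume x: "x \<in> opp_wedge n k c d \<inter> square b h t"
    have "\<sigma> * p $ i \<le> \<sigma> * x $ i"
      using shift_toward[of p b h x t i \<sigma>] p x ti abs by auto
    with abs \<open>\<sigma> * A \<ge> 0\<close> have "A * p $ i \<le> A * x $ i"
      by (rule mult_mono_sgn)
    with sep(1)[of p] sep(2)[of x] p x show False by auto
  qed
  moreover have "measure lebesgue (wedge n k c d \<inter> square b h 0)
      \<le> measure lebesgue (wedge n k c d \<inter> square b h t)"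
  proof -
    have meas: "wedge n k c d \<inter> square b h t \<in> lmeasurable" for t
      by (metis Int_commute fmeasurable_Int_fmeasurable lmeasurable_square sets_lebesgue_wedge(1))
    have "measure lebesgue (wedge n k c d \<inter> square b h 0)
        = measure lebesgue ((+) (h *\<^sub>R t) ` (wedge n k c d \<inter> square b h 0))"
      by (simp add: measure_translation)
    also have "\<dots> \<le> measure lebesgue (wedge n k c d \<inter> square b h t)"
    proof (rule measure_mono_fmeasurable)
      have "0 \<le> n \<bullet> (h *\<^sub>R t)" "0 \<le> k \<bullet> (h *\<^sub>R t)"
        using h nn ti tj by (auto simp: inner_two[OF ij] mult.commute[of \<sigma>] mult.left_commute[of _ h])
      then show "(+) (h *\<^sub>R t) ` (wedge n k c d \<inter> square b h 0) \<subseteq> wedge n k c d \<inter> square b h t"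
        by (auto simp: wedge_def mem_square inner_add_right algebra_simps)
    qed (use meas in \<open>auto intro: fmeasurableD measurable_translation\<close>)
    finally show ?thesis .
  qed
  moreover have "t \<in> shifts"
    using index_two_cases[OF ij] ti tj abs by (force simp: shifts_def abs_if split: if_splits)
  ultimately show ?thesis by blast
qed

text \<open>If both pairs of entries have opposite signs, two axis-parallel lines separate the wedges. They
  meet in the common apex \<open>O'\<close>, which lies in the central cell, and the wedge lies in one quadrant
  around \<open>O'\<close>. The dilation with centre \<open>O'\<close> and factor 2 preserves the wedge, multiplies areas by 4 and
  maps the part of this quadrant in the central cell into that cell and its three neighbours in
  the direction of the quadrant. These three thus carry at least three times the area of the wedge
  in the central cell.\<close>
lemma wedge_shift_quadrant:
  fixes n k b :: "real^2"
  assumes diff: "\<And>i. n $ i * k $ i < 0"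
    and p: "p \<in> wedge n k c d \<inter> square b h 0" and q: "q \<in> opp_wedge n k c d \<inter> square b h 0"
  shows "\<exists>A. A \<subseteq> shifts \<and> (\<forall>t\<in>A. opp_wedge n k c d \<inter> square b h t = {}) \<and>
    measure lebesgue (wedge n k c d \<inter> square b h 0)
      \<le> (\<Sum>t\<in>A. measure lebesgue (wedge n k c d \<inter> square b h t))"
proof -
  let ?W = "wedge n k c d" and ?V = "opp_wedge n k c d"
  define other :: "2 \<Rightarrow> 2" where "other i = i + 1" for i
  have other: "i \<noteq> other i" for i
    by (auto simp: other_def)
  define A where "A i = \<bar>k $ other i\<bar> * n $ i + \<bar>n $ other i\<bar> * k $ i" for i
  define B where "B i = \<bar>k $ other i\<bar> * c + \<bar>n $ other i\<bar> * d" for i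
  note sep = wedge_separation[OF other diff, where c = c and d = d, folded A_def B_def]
  have A0: "A i \<noteq> 0" for i
    using sep(1)[of p i] sep(2)[of q i] p q by auto
  define O' where "O' = (\<chi> i. B i / A i)"
  define \<sigma> where "\<sigma> i = sgn (A i)" for i
  have \<sigma>: "\<bar>\<sigma> i\<bar> = 1" for i
    using A0 by (simp add: \<sigma>_def abs_sgn_eq)
  have W: "\<sigma> i * O' $ i < \<sigma> i * x $ i" if "x \<in> ?W" for x i
    using sep(1)[OF that, of i] A0[of i]
    by (auto simp: \<sigma>_def O'_def sgn_if field_simps split: if_splits)
  have V: "\<sigma> i * x $ i < \<sigma> i * O' $ i" if "x \<in> ?V" for x i
    using sep(2)[OF that, of i] A0[of i]
    by (auto simp: \<sigma>_def O'_def sgn_if field_simps split: if_splits)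
  have apex: "n \<bullet> O' = c" "k \<bullet> O' = d"
  proof -
    have o: "other 1 = 2" "other 2 = 1" by (auto simp: other_def)
    have s: "n $ 1 * k $ 1 < 0" "n $ 2 * k $ 2 < 0" using diff by auto
    have a: "A 1 * O' $ 1 = B 1" "A 2 * O' $ 2 = B 2" using A0 by (auto simp: O'_def)
    have e: "A 1 = \<bar>k $ 2\<bar> * n $ 1 + \<bar>n $ 2\<bar> * k $ 1" "A 2 = \<bar>k $ 1\<bar> * n $ 2 + \<bar>n $ 1\<bar> * k $ 2"
      "B 1 = \<bar>k $ 2\<bar> * c + \<bar>n $ 2\<bar> * d" "B 2 = \<bar>k $ 1\<bar> * c + \<bar>n $ 1\<bar> * d"
      by (auto simp: A_def B_def o)
    \<comment> \<open>Cramer's rule; \<open>A 2\<close> is the determinant up to its sign\<close>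
    define D where "D = n $ 1 * k $ 2 - n $ 2 * k $ 1"
    have "(D = A 2 \<or> D = - A 2)"
      using s unfolding e D_def by (auto simp: mult_less_0_iff)
    then have "D \<noteq> 0" using A0[of 2] by auto
    have "D * O' $ 1 = k $ 2 * c - n $ 2 * d"
      using s a unfolding e D_def by (auto simp: mult_less_0_iff algebra_simps)
    moreover have "D * O' $ 2 = n $ 1 * d - k $ 1 * c"
      using s a unfolding e D_def by (auto simp: mult_less_0_iff algebra_simps)
    ultimately have "D * (n \<bullet> O') = D * c" "D * (k \<bullet> O') = D * d"
      unfolding inner_two[of 1 2, simplified] D_def by algebra+
    then show "n \<bullet> O' = c" "k \<bullet> O' = d" using \<open>D \<noteq> 0\<close> by auto
  qed
  have O'_lo: "\<sigma> i * b $ i - h / 2 \<le> \<sigma> i * O' $ i" and O'_hi: "\<sigma> i * O' $ i \<le> \<sigma> i * b $ i + h / 2" for i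
  proof -
    have "\<bar>q $ i - b $ i\<bar> \<le> h / 2" "\<bar>p $ i - b $ i\<bar> \<le> h / 2"
      using p q by (auto simp: mem_square)
    then show "\<sigma> i * b $ i - h / 2 \<le> \<sigma> i * O' $ i" "\<sigma> i * O' $ i \<le> \<sigma> i * b $ i + h / 2"
      using V[of q i] W[of p i] p q \<sigma>[of i] by (auto simp: abs_if split: if_splits)
  qed
  define S where "S = {t :: real^2. (\<forall>i. t $ i = 0 \<or> t $ i = \<sigma> i) \<and> t \<noteq> 0}"
  have "S \<subseteq> shifts"
    using \<sigma> by (force simp: S_def shifts_def abs_if split: if_splits)
  then have "finite S"
    using finite_shifts finite_subset by blast
  have disj: "?V \<inter> square b h t = {}" if "t \<in> S" for t
  proof (rule equals0I)
    fix x assume x: "x \<in> ?V \<inter> square b h t"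
    obtain i where "t $ i = \<sigma> i"
      using \<open>t \<in> S\<close> by (auto simp: S_def vec_eq_iff)
    then have "\<sigma> i * b $ i + h / 2 \<le> \<sigma> i * x $ i"
      using shift_toward(2)[of p b h x t i "\<sigma> i"] p x \<sigma> by auto
    then show False
      using V[of x i] O'_hi[of i] x by auto
  qed
  let ?f = "\<lambda>x. 2 *\<^sub>R x + (- O')"
  have sub: "?f ` (?W \<inter> square b h 0) \<subseteq> (\<Union>t\<in>insert 0 S. ?W \<inter> square b h t)"
  proof (rule image_subsetI)
    fix x assume x: "x \<in> ?W \<inter> square b h 0"
    have fW: "?f x \<in> ?W"
      using x by (auto simp: wedge_def inner_diff_right inner_add_right apex)
    define t :: "real^2" where
      "t = (\<chi> i. if \<sigma> i * ?f x $ i \<le> \<sigma> i * b $ i + h / 2 then 0 else \<sigma> i)"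
    have "\<bar>?f x $ i - b $ i - t $ i * h\<bar> \<le> h / 2" for i
    proof -
      have "\<bar>x $ i - b $ i\<bar> \<le> h / 2" using x by (auto simp: mem_square)
      then show ?thesis
        using W[of x i] W[OF fW, of i] O'_lo[of i] x \<sigma>[of i]
        by (auto simp: t_def abs_if split: if_splits)
    qed
    moreover have "t \<in> insert 0 S"
      by (auto simp: t_def S_def)
    ultimately show "?f x \<in> (\<Union>t\<in>insert 0 S. ?W \<inter> square b h t)"
      using fW by (auto simp: mem_square)
  qed
  let ?m = "\<lambda>t. measure lebesgue (?W \<inter> square b h t)"
  have meas: "?W \<inter> square b h t \<in> lmeasurable" for t
    by (metis Int_commute fmeasurable_Int_fmeasurable lmeasurable_square sets_lebesgue_wedge(1))
  have "4 * ?m 0 = measure lebesgue (?f ` (?W \<inter> square b h 0))"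
    using emeasure_lebesgue_affine[of 2 "- O'" "?W \<inter> square b h 0"]
    by (simp add: measure_def enn2real_mult)
  also have "\<dots> \<le> measure lebesgue (\<Union>t\<in>insert 0 S. ?W \<inter> square b h t)"
  proof (rule measure_mono_fmeasurable[OF sub])
    show "?f ` (?W \<inter> square b h 0) \<in> sets lebesgue"
      using measurable_translation[OF measurable_linear_image[OF linear_scaleR meas, of 2 0], of "- O'"]
      by (simp add: image_image fmeasurableD)
    show "(\<Union>t\<in>insert 0 S. ?W \<inter> square b h t) \<in> lmeasurable"
      using \<open>finite S\<close> meas by (intro fmeasurable.finite_UN) auto
  qed
  also have "\<dots> \<le> (\<Sum>t\<in>insert 0 S. ?m t)"
    using \<open>finite S\<close> meas by (intro measure_UNION_le) auto
  also have "\<dots> = ?m 0 + (\<Sum>t\<in>S. ?m t)"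
    using \<open>finite S\<close> by (subst sum.insert) (auto simp: S_def)
  finally have "?m 0 \<le> (\<Sum>t\<in>S. ?m t)"
    using measure_nonneg[of lebesgue "?W \<inter> square b h 0"] by linarith
  with \<open>S \<subseteq> shifts\<close> disj show ?thesis by blast
qed

text \<open>On cells that the opposite wedge misses, the difference of the two areas is just the area of the
  wedge. So it is enough to find such cells into which the central part of the wedge can be moved.\<close>
lemma measure_wedge_le:
  fixes n k b :: "real^2"
  assumes h: "h > 0"
  shows "measure lebesgue (square b h 0 \<inter> wedge n k c d) \<le> (\<Sum>t\<in>shifts.
    \<bar>measure lebesgue (square b h t \<inter> wedge n k c d) - measure lebesgue (square b h t \<inter> opp_wedge n k c d)\<bar>)"
    (is "?m 0 \<le> (\<Sum>t\<in>shifts. \<bar>?m t - ?v t\<bar>)")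
proof -
  let ?W = "wedge n k c d" and ?V = "opp_wedge n k c d"
  have meas: "square b h t \<inter> ?W \<in> lmeasurable" "square b h t \<inter> ?V \<in> lmeasurable" for t
    by (simp_all add: fmeasurable_Int_fmeasurable sets_lebesgue_wedge)
  have suff: ?thesis if "A \<subseteq> shifts" "\<And>t. t \<in> A \<Longrightarrow> ?V \<inter> square b h t = {}" "?m 0 \<le> (\<Sum>t\<in>A. ?m t)" for A
  proof -
    have "(\<Sum>t\<in>A. ?m t) = (\<Sum>t\<in>A. \<bar>?m t - ?v t\<bar>)"
      by (rule sum.cong) (use that(2) in \<open>auto simp: Int_commute\<close>)
    also have "\<dots> \<le> (\<Sum>t\<in>shifts. \<bar>?m t - ?v t\<bar>)"
      using that(1) finite_shifts by (intro sum_mono2) auto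
    finally show ?thesis using that(3) by linarith
  qed
  have 0: "0 \<in> shifts" by (simp add: shifts_def)
  consider "?W \<inter> square b h 0 = {}" | "?V \<inter> square b h 0 = {}"
    | p q where "p \<in> ?W \<inter> square b h 0" "q \<in> ?V \<inter> square b h 0"
    by blast
  then show ?thesis
  proof cases
    case 1
    then have "?m 0 = 0" by (simp add: Int_commute)
    then show ?thesis by (simp add: sum_nonneg)
  next
    case 2
    then show ?thesis
      using 0 by (intro suff[of "{0}"]) auto
  next
    case 3
    have axis: ?thesis if ij: "i \<noteq> j" "n $ i * k $ i \<ge> 0" "n $ j * k $ j < 0" for i j
    proof -
      obtain t where "t \<in> shifts" "?V \<inter> square b h t = {}" "?m 0 \<le> ?m t"
        using wedge_shift_axis[OF h ij 3(1)] by (auto simp: Int_commute)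
      then show ?thesis by (intro suff[of "{t}"]) auto
    qed
    consider "\<And>i. n $ i * k $ i \<ge> 0" | "\<And>i. n $ i * k $ i < 0"
      | i j :: 2 where "i \<noteq> j" "n $ i * k $ i \<ge> 0" "n $ j * k $ j < 0"
      by (metis not_le)
    then show ?thesis
    proof cases
      case same: 1
      obtain t where t: "t \<in> shifts" "square b h t \<subseteq> ?W"
        using wedge_shift_both[OF same 3(1)] by blast
      have "?m 0 \<le> measure lebesgue (square b h 0)"
        using meas by (intro measure_mono_fmeasurable) auto
      also have "\<dots> = measure lebesgue (square b h t)"
        using h by (simp add: measure_square)
      also have "\<dots> = ?m t"
        using t(2) by (simp add: Int_absorb2)
      finally have "?m 0 \<le> ?m t" .
      moreover have "?V \<inter> square b h t = {}"
        using t(2) by (auto simp: wedge_def opp_wedge_def)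
      ultimately show ?thesis
        using t(1) by (intro suff[of "{t}"]) auto
    next
      case diff: 2
      then show ?thesis
        using wedge_shift_quadrant[OF diff 3] suff by (auto simp: Int_commute)
    next
      case 3
      then show ?thesis using axis by blast
    qed
  qed
qed

lemma sets_lebesgue_half_plane [measurable]:
  fixes n c :: "'a::euclidean_space"
  shows "{x. d \<le> n \<bullet> (x - c)} \<in> sets lebesgue"
  using lebesgue_closedin[of UNIV "{x. d \<le> n \<bullet> (x - c)}"]
  by (simp add: closed_Collect_le continuous_intros)

lemma fmeasurable_Int_neq:
  assumes "A \<in> sets M" "B \<in> sets M" "T \<in> fmeasurable M"
  shows "T \<inter> {x. (x \<in> A) \<noteq> (x \<in> B)} \<in> fmeasurable M"
proof -
  have "T \<inter> {x. (x \<in> A) \<noteq> (x \<in> B)} = T \<inter> ((A - B) \<union> (B - A))" by auto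
  then show ?thesis using assms by (auto intro!: fmeasurable_Int_fmeasurable)
qed

text \<open>Intersections with \<open>P\<close> and with \<open>Q\<close> have \<open>P \<inter> Q\<close> in common, so their areas differ by the
  difference of the two wedges. The preceding bound applies to either wedge, because exchanging \<open>P\<close>
  and \<open>Q\<close> exchanges the wedges; this explains the factor 2.\<close>
lemma half_plane_stability:
  fixes n m b :: "real^2"
  assumes h: "h > 0"
  shows "measure lebesgue (square b h 0 \<inter> {x. (c \<le> n \<bullet> x) \<noteq> (d \<le> m \<bullet> x)}) \<le> 2 * (\<Sum>t\<in>shifts.
    \<bar>measure lebesgue (square b h t \<inter> {x. c \<le> n \<bullet> x}) - measure lebesgue (square b h t \<inter> {x. d \<le> m \<bullet> x})\<bar>)"
    (is "_ \<le> 2 * (\<Sum>t\<in>shifts. \<bar>?P t - ?Q t\<bar>)")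
proof -
  let ?W = "wedge n (- m) c (- d)" and ?V = "opp_wedge n (- m) c (- d)"
  have meas: "square b h t \<inter> ?W \<in> lmeasurable" "square b h t \<inter> ?V \<in> lmeasurable" for t
    by (simp_all add: fmeasurable_Int_fmeasurable sets_lebesgue_wedge)
  have meas2: "square b h t \<inter> {x. c \<le> n \<bullet> x \<and> d \<le> m \<bullet> x} \<in> lmeasurable" for t
  proof (intro fmeasurable_Int_fmeasurable)
    show "{x. c \<le> n \<bullet> x \<and> d \<le> m \<bullet> x} \<in> sets lebesgue"
      using lebesgue_closedin[of UNIV "{x. c \<le> n \<bullet> x \<and> d \<le> m \<bullet> x}"]
      by (simp add: closed_Collect_conj closed_Collect_le continuous_intros)
  qed simp
  have P: "?P t = measure lebesgue (square b h t \<inter> {x. c \<le> n \<bullet> x \<and> d \<le> m \<bullet> x}) + measure lebesgue (square b h t \<inter> ?W)"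
    and Q: "?Q t = measure lebesgue (square b h t \<inter> {x. c \<le> n \<bullet> x \<and> d \<le> m \<bullet> x}) + measure lebesgue (square b h t \<inter> ?V)" for t
  proof -
    have "square b h t \<inter> {x. c \<le> n \<bullet> x} = (square b h t \<inter> {x. c \<le> n \<bullet> x \<and> d \<le> m \<bullet> x}) \<union> (square b h t \<inter> ?W)"
      "square b h t \<inter> {x. d \<le> m \<bullet> x} = (square b h t \<inter> {x. c \<le> n \<bullet> x \<and> d \<le> m \<bullet> x}) \<union> (square b h t \<inter> ?V)"
      by (auto simp: wedge_def opp_wedge_def)
    moreover have "(square b h t \<inter> {x. c \<le> n \<bullet> x \<and> d \<le> m \<bullet> x}) \<inter> (square b h t \<inter> ?W) = {}"
      "(square b h t \<inter> {x. c \<le> n \<bullet> x \<and> d \<le> m \<bullet> x}) \<inter> (square b h t \<inter> ?V) = {}"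
      by (auto simp: wedge_def opp_wedge_def)
    ultimately show "?P t = measure lebesgue (square b h t \<inter> {x. c \<le> n \<bullet> x \<and> d \<le> m \<bullet> x}) + measure lebesgue (square b h t \<inter> ?W)"
      "?Q t = measure lebesgue (square b h t \<inter> {x. c \<le> n \<bullet> x \<and> d \<le> m \<bullet> x}) + measure lebesgue (square b h t \<inter> ?V)"
      using measure_Un3[OF meas2 meas(1), of t t] measure_Un3[OF meas2 meas(2), of t t] by simp_all
  qed
  have diff: "measure lebesgue (square b h t \<inter> ?W) - measure lebesgue (square b h t \<inter> ?V) = ?P t - ?Q t" for t
    unfolding P Q by simp
  have swap: "wedge m (- n) d (- c) = ?V" "opp_wedge m (- n) d (- c) = ?W"
    by (auto simp: wedge_def opp_wedge_def)
  have "measure lebesgue (square b h 0 \<inter> {x. (c \<le> n \<bullet> x) \<noteq> (d \<le> m \<bullet> x)})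
      = measure lebesgue ((square b h 0 \<inter> ?W) \<union> (square b h 0 \<inter> ?V))"
    by (rule arg_cong[of _ _ "measure lebesgue"]) (auto simp: wedge_def opp_wedge_def)
  also have "\<dots> \<le> measure lebesgue (square b h 0 \<inter> ?W) + measure lebesgue (square b h 0 \<inter> ?V)"
    using meas by (intro measure_Un_le) auto
  also have "\<dots> \<le> (\<Sum>t\<in>shifts. \<bar>?P t - ?Q t\<bar>) + (\<Sum>t\<in>shifts. \<bar>?P t - ?Q t\<bar>)"
    using measure_wedge_le[OF h, of b n "- m" c "- d"] measure_wedge_le[OF h, of b m "- n" d "- c"]
    unfolding swap diff by (simp add: diff abs_minus_commute[of "measure _ (_ \<inter> ?V)"])
  finally show ?thesis by simp
qed

section \<open>Hoelder regular functions are locally affine\<close>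

text \<open>The norm only bounds the function almost everywhere; by continuity the set where the bound
  holds is closed, and a closed set that contains almost every point of an interval contains
  all of them.\<close>
lemma Lp_norm_infinity_bound:
  fixes f :: "real \<Rightarrow> real"
  assumes ab: "a < b" and cont: "continuous_on {a..b} f" and M: "M \<ge> 0"
    and norm: "Lp_norm (lebesgue_on {a..b}) \<infinity> f \<le> ennreal M" and x: "x \<in> {a..b}"
  shows "\<bar>f x\<bar> \<le> M"
proof -
  have "esssup (lebesgue_on {a..b}) (\<lambda>x. ennreal \<bar>f x\<bar>) \<le> ennreal M"
    using norm by (auto simp: Lp_norm_def top_unique split: if_splits)
  then have "AE x in lebesgue_on {a..b}. ennreal \<bar>f x\<bar> \<le> ennreal M"
    using esssup_AE[of "\<lambda>x. ennreal \<bar>f x\<bar>" "lebesgue_on {a..b}"] by (auto elim: eventually_mono)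
  then have AE: "AE x\<in>{a<..<b} in lebesgue. \<bar>f x\<bar> \<le> M"
    using M by (simp add: AE_restrict_space_iff) (auto elim: eventually_mono)
  define C where "C = {x \<in> {a..b}. \<bar>f x\<bar> \<le> M}"
  have "closed C"
    using continuous_closed_preimage[OF continuous_on_rabs[OF cont], of "{..M}"]
    by (auto simp: C_def vimage_def Int_def)
  have "{a<..<b} \<subseteq> C"
  proof
    fix y assume y: "y \<in> {a<..<b}"
    have "AE x\<in>{a<..<b} in lebesgue. x \<in> C"
      using AE by eventually_elim (auto simp: C_def)
    then show "y \<in> C"
      by (rule mem_closed_if_AE_lebesgue_open[OF open_greaterThanLessThan \<open>closed C\<close> _ y])
  qed
  then have "closure {a<..<b} \<subseteq> C"
    using \<open>closed C\<close> by (simp add: closure_minimal)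
  then show ?thesis
    using x ab by (auto simp: C_def)
qed

lemma holder_imp_continuous_on:
  fixes g :: "real \<Rightarrow> real"
  assumes "\<alpha> > 0" "M > 0"
    and bd: "\<And>a b. a \<in> I \<Longrightarrow> b \<in> I \<Longrightarrow> \<bar>g a - g b\<bar> \<le> M * \<bar>a - b\<bar> powr \<alpha>"
  shows "continuous_on I g"
  unfolding continuous_on_iff
proof (intro ballI allI impI)
  fix x e :: real assume x: "x \<in> I" and e: "0 < e"
  show "\<exists>d>0. \<forall>x'\<in>I. dist x' x < d \<longrightarrow> dist (g x') (g x) < e"
  proof (intro exI[of _ "(e / M) powr (1 / \<alpha>)"] conjI ballI impI)
    show "0 < (e / M) powr (1 / \<alpha>)" using e assms by simp
    fix y assume y: "y \<in> I" "dist y x < (e / M) powr (1 / \<alpha>)"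
    have "\<bar>g y - g x\<bar> \<le> M * \<bar>y - x\<bar> powr \<alpha>" using bd x y by auto
    also have "\<dots> < M * ((e / M) powr (1 / \<alpha>)) powr \<alpha>"
      using y assms by (intro mult_strict_left_mono powr_less_mono2) (auto simp: dist_real_def)
    also have "\<dots> = e" using e assms by (simp add: powr_powr)
    finally show "dist (g y) (g x) < e" by (simp add: dist_real_def)
  qed
qed

lemma real_deriv_bound_imp_lipschitz:
  fixes f f' :: "real \<Rightarrow> real"
  assumes "\<And>x. x \<in> {a..b} \<Longrightarrow> (f has_real_derivative f' x) (at x within {a..b})"
    and "\<And>x. x \<in> {a..b} \<Longrightarrow> \<bar>f' x\<bar> \<le> M" and "x \<in> {a..b}" "y \<in> {a..b}"
  shows "\<bar>f x - f y\<bar> \<le> M * \<bar>x - y\<bar>"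
  using field_differentiable_bound[of "{a..b}" f f' M x y] assms by auto

text \<open>For \<open>s = 1\<close> the function is Lipschitz and is approximated by constants. For \<open>s > 1\<close> it is
  differentiable, and its derivative is bounded by \<open>M\<close> and Hoelder continuous with constant \<open>M\<close> and
  exponent \<open>min s 2 - 1\<close>: directly from the norm if \<open>s \<le> 2\<close>, from the bound on the second derivative
  otherwise. The mean value theorem then bounds the deviation from the tangent.\<close>
lemma holder_taylor:
  fixes \<psi> :: "real \<Rightarrow> real"
  assumes s: "s \<ge> 1" and R: "R > 0" and M: "M > 0"
    and \<psi>: "\<psi> \<in> holder_space s {-R..R}" "holder_norm s {-R..R} \<psi> \<le> ennreal M"
  shows holder_lipschitz: "\<And>x y. x \<in> {-R..R} \<Longrightarrow> y \<in> {-R..R} \<Longrightarrow> \<bar>\<psi> x - \<psi> y\<bar> \<le> M * \<bar>x - y\<bar>"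
    and holder_affine_approx: "\<And>a. a \<in> {-R..R} \<Longrightarrow> \<exists>m. \<bar>m\<bar> \<le> M \<and>
      (\<forall>z\<in>{-R..R}. \<bar>\<psi> z - \<psi> a - m * (z - a)\<bar> \<le> M * \<bar>z - a\<bar> powr min s 2)"
proof -
  define I where "I = {-R..R}"
  define K where "K = holder_order s"
  define D where "D k = nth_deriv_within I k \<psi>" for k
  have D0: "D 0 = \<psi>" by (simp add: D_def)
  have sK: "real K < s" "s \<le> real K + 1"
    using s unfolding K_def holder_order_def by linarith+
  have le: "(SUP k\<in>{0..K}. Lp_norm (lebesgue_on I) \<infinity> (D k)) +
      (SUP (a, b)\<in>{(a, b). a \<in> I \<and> b \<in> I \<and> a \<noteq> b}.
         ennreal (\<bar>D K a - D K b\<bar> / \<bar>a - b\<bar> powr (s - real K))) \<le> ennreal M"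
    using \<psi>(2) by (simp add: holder_norm_def Let_def I_def K_def D_def)
  have norm: "Lp_norm (lebesgue_on I) \<infinity> (D k) \<le> ennreal M" if "k \<le> K" for k
    by (rule order_trans[OF SUP_upper order_trans[OF add_increasing2[OF zero_le order_refl] le]]) (use that in auto)
  have hoelder: "\<bar>D K a - D K b\<bar> \<le> M * \<bar>a - b\<bar> powr (s - real K)" if "a \<in> I" "b \<in> I" for a b
  proof (cases "a = b")
    case False
    have "ennreal (\<bar>D K a - D K b\<bar> / \<bar>a - b\<bar> powr (s - real K)) \<le> ennreal M"
      by (rule order_trans[OF SUP_upper2[of "(a, b)"] order_trans[OF add_increasing[OF zero_le order_refl] le]])
        (use that False in auto)
    then show ?thesis
      using False M by (simp add: divide_simps)
  qed (use M in auto)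
  have deriv: "(D k has_real_derivative D (Suc k) x) (at x within I)" if "k < K" "x \<in> I" for k x
  proof -
    have "D k differentiable (at x within I)"
      using \<psi>(1) that by (auto simp: holder_space_def I_def K_def D_def)
    then show ?thesis
      by (simp add: D_def vector_derivative_works has_real_derivative_iff_has_vector_derivative)
  qed
  have cont: "continuous_on I (D k)" if "k \<le> K" for k
  proof (cases "k = K")
    case True
    show ?thesis
      unfolding True by (rule holder_imp_continuous_on[OF _ M hoelder]) (use sK in auto)
  next
    case False
    then show ?thesis
      using that by (intro DERIV_continuous_on[OF deriv]) auto
  qed
  have bound: "\<bar>D k x\<bar> \<le> M" if "k \<le> K" "x \<in> I" for k x
    using Lp_norm_infinity_bound[of "-R" R "D k" M x] cont[OF that(1)] norm[OF that(1)] that(2) R M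
    by (auto simp: I_def)
  have lip: "\<bar>D k x - D k y\<bar> \<le> M * \<bar>x - y\<bar>" if "k < K" "x \<in> I" "y \<in> I" for k x y
    by (rule real_deriv_bound_imp_lipschitz[of "-R" R, folded I_def, OF deriv bound])
      (use that in auto)
  show lipschitz: "\<bar>\<psi> x - \<psi> y\<bar> \<le> M * \<bar>x - y\<bar>" if "x \<in> {-R..R}" "y \<in> {-R..R}" for x y
  proof (cases "K = 0")
    case True
    then have "s = 1" using sK s by auto
    then show ?thesis using hoelder[of x y] that True by (simp add: D0 I_def)
  next
    case False
    then show ?thesis using lip[of 0 x y] that by (simp add: D0 I_def)
  qed
  show "\<exists>m. \<bar>m\<bar> \<le> M \<and> (\<forall>z\<in>{-R..R}. \<bar>\<psi> z - \<psi> a - m * (z - a)\<bar> \<le> M * \<bar>z - a\<bar> powr min s 2)"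
    if a: "a \<in> {-R..R}" for a
  proof (cases "K = 0")
    case True
    then have "s = 1" using sK s by auto
    then show ?thesis using lipschitz a M by (intro exI[of _ 0]) auto
  next
    case False
    have D1: "\<bar>D 1 x - D 1 y\<bar> \<le> M * \<bar>x - y\<bar> powr (min s 2 - 1)" if "x \<in> I" "y \<in> I" for x y
    proof (cases "K = 1")
      case True
      then have "min s 2 - 1 = s - real K" using sK by auto
      then show ?thesis using hoelder[of x y] that True by simp
    next
      case K: False
      then have "real K \<ge> 2" using False by auto
      then have "min s 2 = 2" using sK by auto
      then show ?thesis using lip[of 1 x y] that K False by simp
    qed
    show ?thesis
    proof (intro exI[of _ "D 1 a"] conjI ballI)
      show "\<bar>D 1 a\<bar> \<le> M" using bound[of 1 a] False a by (simp add: I_def)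
      fix z assume z: "z \<in> {-R..R}"
      have d: "(\<psi> has_derivative (\<lambda>t. D 1 x * t)) (at x within {min a z..max a z})"
        if "x \<in> {min a z..max a z}" for x
      proof -
        have sub: "{min a z..max a z} \<subseteq> I"
          using a z by (auto simp: I_def)
        have "(\<psi> has_real_derivative D 1 x) (at x within I)"
          using deriv[of 0 x] False that sub unfolding D0 One_nat_def by blast
        then have "(\<psi> has_real_derivative D 1 x) (at x within {min a z..max a z})"
          using sub by (rule has_field_derivative_subset)
        then show ?thesis by (simp add: has_field_derivative_def)
      qed
      have "min a z \<le> max a z" by simp
      then obtain \<xi> where \<xi>: "\<xi> \<in> {min a z..max a z}" "\<psi> (max a z) - \<psi> (min a z) = D 1 \<xi> * (max a z - min a z)"
        using mvt_very_simple[OF _ d[OF atLeastAtMost_iff[THEN iffD2, OF conjI]]] by blast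
      then have eq: "\<psi> z - \<psi> a = D 1 \<xi> * (z - a)"
        by (auto simp: max_def min_def algebra_simps split: if_splits)
      have "\<bar>\<psi> z - \<psi> a - D 1 a * (z - a)\<bar> = \<bar>D 1 \<xi> - D 1 a\<bar> * \<bar>z - a\<bar>"
        unfolding eq by (simp add: abs_mult left_diff_distrib[symmetric])
      also have "\<dots> \<le> (M * \<bar>\<xi> - a\<bar> powr (min s 2 - 1)) * \<bar>z - a\<bar>"
        using \<xi> a z by (intro mult_right_mono D1) (auto simp: I_def)
      also have "\<dots> \<le> (M * \<bar>z - a\<bar> powr (min s 2 - 1)) * \<bar>z - a\<bar>"
        using \<xi> M s by (intro mult_right_mono mult_left_mono powr_mono2) (auto simp: min_def max_def split: if_splits)
      also have "\<dots> = M * \<bar>z - a\<bar> powr min s 2"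
        by (cases "z = a") (simp_all add: powr_diff)
      finally show "\<bar>\<psi> z - \<psi> a - D 1 a * (z - a)\<bar> \<le> M * \<bar>z - a\<bar> powr min s 2" .
    qed
  qed
qed

section \<open>Subgraphs of smooth functions in rotated coordinates\<close>

lemma orthonormal_expansion:
  fixes e\<^sub>1 e\<^sub>2 y :: "real^2"
  assumes "norm e\<^sub>1 = 1" "norm e\<^sub>2 = 1" "e\<^sub>1 \<bullet> e\<^sub>2 = 0"
  shows "y = (y \<bullet> e\<^sub>1) *\<^sub>R e\<^sub>1 + (y \<bullet> e\<^sub>2) *\<^sub>R e\<^sub>2"
proof -
  define a b c d where "a = e\<^sub>1 $ 1" and "b = e\<^sub>1 $ 2" and "c = e\<^sub>2 $ 1" and "d = e\<^sub>2 $ 2"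
  note abcd = a_def[symmetric] b_def[symmetric] c_def[symmetric] d_def[symmetric]
  have 1: "a * a + b * b = 1" "c * c + d * d = 1" "a * c + b * d = 0"
    using assms by (simp_all add: norm_eq_1 inner_vec_def sum_2 abcd)
  have "a * a = d * d" "a * b + c * d = 0"
    using 1 by algebra+
  then have 2: "a * a + c * c = 1" "b * b + d * d = 1" "a * b + c * d = 0"
    using 1 by auto
  have "(u * a + v * b) * a + (u * c + v * d) * c = u" "(u * a + v * b) * b + (u * c + v * d) * d = v" for u v
    using 2 by algebra+
  then show ?thesis
    by (simp add: vec_eq_iff forall_2 inner_vec_def sum_2 abcd)
qed

text \<open>Squares of side proportional to \<open>\<epsilon>\<close>, centred on the graph at parameters \<open>\<epsilon>\<close> apart, cover the strip,
  and there are at most \<open>2 r / \<epsilon> + 1\<close> of them. A cover by squares is insensitive to the rotation of the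
  coordinates.\<close>
lemma measure_lipschitz_strip:
  fixes e\<^sub>1 e\<^sub>2 x\<^sub>0 :: "real^2" and g :: "real \<Rightarrow> real"
  assumes e: "norm e\<^sub>1 = 1" "norm e\<^sub>2 = 1"
    and lip: "\<And>u v. u \<in> {a-r..a+r} \<Longrightarrow> v \<in> {a-r..a+r} \<Longrightarrow> \<bar>g u - g v\<bar> \<le> K * \<bar>u - v\<bar>"
    and "r \<ge> 0" "\<epsilon> > 0" "K \<ge> 0"
  shows "\<exists>U\<in>lmeasurable. measure lebesgue U \<le> 4 * (2 + K)\<^sup>2 * (2 * r + \<epsilon>) * \<epsilon> \<and>
    (\<forall>z\<^sub>1 z\<^sub>2. \<bar>z\<^sub>1 - a\<bar> \<le> r \<longrightarrow> \<bar>z\<^sub>2 - g z\<^sub>1\<bar> \<le> \<epsilon> \<longrightarrow> x\<^sub>0 + z\<^sub>1 *\<^sub>R e\<^sub>1 + z\<^sub>2 *\<^sub>R e\<^sub>2 \<in> U)"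
proof -
  define N where "N = nat \<lfloor>2 * r / \<epsilon>\<rfloor>"
  define t where "t k = a - r + real k * \<epsilon>" for k
  define \<rho> where "\<rho> = (2 + K) * \<epsilon>"
  define U where "U = (\<Union>k\<in>{..N}. square (x\<^sub>0 + t k *\<^sub>R e\<^sub>1 + g (t k) *\<^sub>R e\<^sub>2) (2 * \<rho>) 0)"
  have "\<rho> > 0" using assms by (simp add: \<rho>_def)
  have N: "real N \<le> 2 * r / \<epsilon>"
    using assms by (simp add: N_def)
  have "measure lebesgue U \<le> (\<Sum>k\<in>{..N}. (2 * \<rho>)\<^sup>2)"
    unfolding U_def using \<open>\<rho> > 0\<close>
    by (intro order_trans[OF measure_UNION_le]) (auto simp: measure_square fmeasurableD)
  also have "\<dots> = (real N + 1) * (2 * \<rho>)\<^sup>2"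
    by simp
  also have "\<dots> \<le> (2 * r / \<epsilon> + 1) * (2 * \<rho>)\<^sup>2"
    using N by (intro mult_right_mono) auto
  also have "\<dots> = 4 * (2 + K)\<^sup>2 * (2 * r + \<epsilon>) * \<epsilon>"
    using assms by (simp add: \<rho>_def field_simps power2_eq_square)
  finally have "measure lebesgue U \<le> 4 * (2 + K)\<^sup>2 * (2 * r + \<epsilon>) * \<epsilon>" .
  moreover have "U \<in> lmeasurable"
    by (auto simp: U_def intro!: fmeasurable.finite_UN)
  moreover have "x\<^sub>0 + z\<^sub>1 *\<^sub>R e\<^sub>1 + z\<^sub>2 *\<^sub>R e\<^sub>2 \<in> U" if z: "\<bar>z\<^sub>1 - a\<bar> \<le> r" "\<bar>z\<^sub>2 - g z\<^sub>1\<bar> \<le> \<epsilon>" for z\<^sub>1 z\<^sub>2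
  proof -
    define k where "k = nat \<lfloor>(z\<^sub>1 - (a - r)) / \<epsilon>\<rfloor>"
    have nn: "(z\<^sub>1 - (a - r)) / \<epsilon> \<ge> 0" using z assms by auto
    then have k: "real k \<le> (z\<^sub>1 - (a - r)) / \<epsilon>" "(z\<^sub>1 - (a - r)) / \<epsilon> < real k + 1"
      unfolding k_def by linarith+
    have "k \<le> N"
      unfolding k_def N_def using z assms by (intro nat_mono floor_mono divide_right_mono) auto
    have tk: "t k \<le> z\<^sub>1" "z\<^sub>1 < t k + \<epsilon>"
      using k assms by (simp_all add: t_def field_simps)
    have tk_in: "t k \<in> {a-r..a+r}" "z\<^sub>1 \<in> {a-r..a+r}"
      using tk z assms by (auto simp: t_def)
    have "\<bar>g z\<^sub>1 - g (t k)\<bar> \<le> K * \<epsilon>"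
      using tk assms by (intro order_trans[OF lip[OF tk_in(2,1)]] mult_left_mono) auto
    then have g: "\<bar>z\<^sub>2 - g (t k)\<bar> \<le> \<epsilon> + K * \<epsilon>"
      using z by linarith
    let ?d = "(z\<^sub>1 - t k) *\<^sub>R e\<^sub>1 + (z\<^sub>2 - g (t k)) *\<^sub>R e\<^sub>2"
    have "norm ?d \<le> \<bar>z\<^sub>1 - t k\<bar> + \<bar>z\<^sub>2 - g (t k)\<bar>"
      using norm_triangle_ineq[of "(z\<^sub>1 - t k) *\<^sub>R e\<^sub>1" "(z\<^sub>2 - g (t k)) *\<^sub>R e\<^sub>2"] e by simp
    also have "\<dots> \<le> \<rho>"
      using tk g by (simp add: \<rho>_def algebra_simps)
    finally have "\<bar>?d $ i\<bar> \<le> \<rho>" for i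
      using component_le_norm_cart[of ?d i] by linarith
    then have "x\<^sub>0 + z\<^sub>1 *\<^sub>R e\<^sub>1 + z\<^sub>2 *\<^sub>R e\<^sub>2 \<in> square (x\<^sub>0 + t k *\<^sub>R e\<^sub>1 + g (t k) *\<^sub>R e\<^sub>2) (2 * \<rho>) 0"
      by (simp add: mem_square algebra_simps)
    then show ?thesis
      using \<open>k \<le> N\<close> by (auto simp: U_def)
  qed
  ultimately show ?thesis by blast
qed

lemma half_plane_of_subgraph:
  fixes e\<^sub>1 e\<^sub>2 x\<^sub>0 c :: "real^2"
  assumes e: "norm e\<^sub>1 = 1" "norm e\<^sub>2 = 1" "e\<^sub>1 \<bullet> e\<^sub>2 = 0"
  shows "\<exists>n d. norm n = 1 \<and> (\<forall>x. d \<le> n \<bullet> (x - c) \<longleftrightarrow> (x - x\<^sub>0) \<bullet> e\<^sub>2 \<le> \<beta> + m * ((x - x\<^sub>0) \<bullet> e\<^sub>1 - a))"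
proof -
  define n where "n = m *\<^sub>R e\<^sub>1 - e\<^sub>2"
  define d where "d = m * a - \<beta> + n \<bullet> (x\<^sub>0 - c)"
  have ee: "e\<^sub>1 \<bullet> e\<^sub>1 = 1" "e\<^sub>2 \<bullet> e\<^sub>2 = 1" "e\<^sub>2 \<bullet> e\<^sub>1 = 0"
    using e by (simp_all only: norm_eq_1 inner_commute[of e\<^sub>2 e\<^sub>1])
  have "n \<bullet> e\<^sub>2 = - 1"
    by (simp add: n_def inner_diff_left ee e(3))
  then have "n \<noteq> 0" by auto
  then have n: "norm n > 0" by simp
  show ?thesis
  proof (intro exI[of _ "n /\<^sub>R norm n"] exI[of _ "d / norm n"] conjI allI)
    show "norm (n /\<^sub>R norm n) = 1" using n by simp
    fix x
    have "d / norm n \<le> (n /\<^sub>R norm n) \<bullet> (x - c) \<longleftrightarrow> d \<le> n \<bullet> (x - c)"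
      using n by (simp add: field_simps)
    also have "\<dots> \<longleftrightarrow> (x - x\<^sub>0) \<bullet> e\<^sub>2 \<le> \<beta> + m * ((x - x\<^sub>0) \<bullet> e\<^sub>1 - a)"
    proof -
      have "n \<bullet> (x - c) - n \<bullet> (x\<^sub>0 - c) = n \<bullet> (x - x\<^sub>0)"
        by (simp add: inner_diff_right)
      also have "\<dots> = m * ((x - x\<^sub>0) \<bullet> e\<^sub>1) - (x - x\<^sub>0) \<bullet> e\<^sub>2"
        by (simp only: n_def inner_diff_left inner_scaleR_left inner_commute[of e\<^sub>1 "x - x\<^sub>0"] inner_commute[of e\<^sub>2 "x - x\<^sub>0"])
      finally show ?thesis
        by (auto simp: d_def right_diff_distrib)
    qed
    finally show "d / norm n \<le> (n /\<^sub>R norm n) \<bullet> (x - c) \<longleftrightarrow> (x - x\<^sub>0) \<bullet> e\<^sub>2 \<le> \<beta> + m * ((x - x\<^sub>0) \<bullet> e\<^sub>1 - a)" .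
  qed
qed

lemma norm_square_le:
  fixes x c :: "real^2"
  assumes "x \<in> square c l 0"
  shows "norm (x - c) \<le> l"
proof -
  have "norm (x - c) \<le> \<bar>(x - c) $ 1\<bar> + \<bar>(x - c) $ 2\<bar>"
    using norm_le_l1_cart[of "x - c"] by (simp add: sum_2)
  moreover have "\<bar>(x - c) $ i\<bar> \<le> l / 2" for i
    using assms by (auto simp: mem_square)
  from this[of 1] this[of 2] have "\<bar>(x - c) $ 1\<bar> + \<bar>(x - c) $ 2\<bar> \<le> l" by linarith
  ultimately show ?thesis by linarith
qed

lemma inner_unit_le: "norm e = 1 \<Longrightarrow> \<bar>x \<bullet> e\<bar> \<le> norm x"
  using Cauchy_Schwarz_ineq2[of x e] by simp

text \<open>The set \<open>U\<close> covers the points at height at most \<open>\<epsilon> = 6 (1 + M) h\<close> above or below the graph. Any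
  two points of the stencil have distance at most \<open>6 h\<close>, so their heights differ by at most \<open>\<epsilon>\<close>: if
  the stencil contains points on either side of the graph, then its central cell lies in \<open>U\<close>. In this
  case the half-plane below the line that approximates the graph at \<open>c\<close> differs from \<open>\<Omega>\<close> only within
  height \<open>\<delta> = M (3 h)\<^sup>\<alpha>\<close> of this line, over an interval of length \<open>6 h\<close>. This strip has area \<open>O(h\<^sup>\<alpha>\<^sup>+\<^sup>1)\<close>,
  that is \<open>O(h\<^sup>\<alpha>\<^sup>-\<^sup>1)\<close> times the area of
  the central cell. In the other cases a half-plane agrees with \<open>\<Omega>\<close> on the whole stencil.\<close>
lemma subgraph_local_approximation:
  fixes e\<^sub>1 e\<^sub>2 x\<^sub>0 :: "real^2" and \<psi> :: "real \<Rightarrow> real" and \<Omega> :: "(real^2) set"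
  assumes \<Omega>: "\<Omega> \<in> sets lebesgue"
    and e: "norm e\<^sub>1 = 1" "norm e\<^sub>2 = 1" "e\<^sub>1 \<bullet> e\<^sub>2 = 0"
    and graph: "\<And>z\<^sub>1 z\<^sub>2. \<bar>z\<^sub>1\<bar> \<le> R \<Longrightarrow> \<bar>z\<^sub>2\<bar> \<le> R \<Longrightarrow> x\<^sub>0 + z\<^sub>1 *\<^sub>R e\<^sub>1 + z\<^sub>2 *\<^sub>R e\<^sub>2 \<in> \<Omega> \<longleftrightarrow> z\<^sub>2 \<le> \<psi> z\<^sub>1"
    and lip: "\<And>u v. u \<in> {-R..R} \<Longrightarrow> v \<in> {-R..R} \<Longrightarrow> \<bar>\<psi> u - \<psi> v\<bar> \<le> M * \<bar>u - v\<bar>"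
    and approx: "\<And>a. a \<in> {-R..R} \<Longrightarrow> \<exists>m. \<bar>m\<bar> \<le> M \<and>
      (\<forall>z\<in>{-R..R}. \<bar>\<psi> z - \<psi> a - m * (z - a)\<bar> \<le> M * \<bar>z - a\<bar> powr \<alpha>)"
    and \<alpha>: "1 \<le> \<alpha>" "\<alpha> \<le> 2" and M: "M > 0" and h: "0 < h" "6 * h \<le> R" and R: "R \<le> 1"
  shows "\<exists>U\<in>lmeasurable. measure lebesgue U \<le> 24 * (2 + M)\<^sup>2 * (3 + M) * (1 + M) * h \<and>
    (\<forall>c. norm (c - x\<^sub>0) \<le> R / 2 \<longrightarrow> (\<exists>n d. norm n = 1 \<and>
      measure lebesgue (square c (3 * h) 0 \<inter> {x. (x \<in> \<Omega>) \<noteq> (d \<le> n \<bullet> (x - c))})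
        \<le> 108 * M * (2 + M)^3 * h powr (\<alpha> - 1) * measure lebesgue (square c h 0 \<inter> U)))"
proof -
  define \<epsilon> where "\<epsilon> = 6 * (1 + M) * h"
  have "\<epsilon> > 0" using M h by (simp add: \<epsilon>_def)
  define z1 z2 where "z1 x = (x - x\<^sub>0) \<bullet> e\<^sub>1" and "z2 x = (x - x\<^sub>0) \<bullet> e\<^sub>2" for x
  have expand: "x\<^sub>0 + z1 x *\<^sub>R e\<^sub>1 + z2 x *\<^sub>R e\<^sub>2 = x" for x
    using orthonormal_expansion[OF e, of "x - x\<^sub>0"] by (simp add: z1_def z2_def algebra_simps)
  have "\<exists>U\<in>lmeasurable. measure lebesgue U \<le> 4 * (2 + M)\<^sup>2 * (2 * R + \<epsilon>) * \<epsilon> \<and>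
    (\<forall>z\<^sub>1 z\<^sub>2. \<bar>z\<^sub>1 - 0\<bar> \<le> R \<longrightarrow> \<bar>z\<^sub>2 - \<psi> z\<^sub>1\<bar> \<le> \<epsilon> \<longrightarrow> x\<^sub>0 + z\<^sub>1 *\<^sub>R e\<^sub>1 + z\<^sub>2 *\<^sub>R e\<^sub>2 \<in> U)"
    by (rule measure_lipschitz_strip) (use e lip h M \<open>\<epsilon> > 0\<close> in auto)
  then obtain U where U: "U \<in> lmeasurable" "measure lebesgue U \<le> 4 * (2 + M)\<^sup>2 * (2 * R + \<epsilon>) * \<epsilon>"
    and inU: "\<And>z\<^sub>1 z\<^sub>2. \<bar>z\<^sub>1\<bar> \<le> R \<Longrightarrow> \<bar>z\<^sub>2 - \<psi> z\<^sub>1\<bar> \<le> \<epsilon> \<Longrightarrow> x\<^sub>0 + z\<^sub>1 *\<^sub>R e\<^sub>1 + z\<^sub>2 *\<^sub>R e\<^sub>2 \<in> U"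
    by auto
  have "\<epsilon> \<le> 1 + M"
  proof -
    have "(1 + M) * (6 * h) \<le> (1 + M) * 1" using M h R by (intro mult_left_mono) auto
    then show ?thesis by (simp add: \<epsilon>_def mult_ac)
  qed
  then have "4 * (2 + M)\<^sup>2 * (2 * R + \<epsilon>) * \<epsilon> \<le> 4 * (2 + M)\<^sup>2 * (3 + M) * \<epsilon>"
    using R \<open>\<epsilon> > 0\<close> by (intro mult_right_mono mult_left_mono) auto
  with U(2) have U2: "measure lebesgue U \<le> 24 * (2 + M)\<^sup>2 * (3 + M) * (1 + M) * h"
    by (simp add: \<epsilon>_def algebra_simps)
  have "\<exists>n d. norm n = 1 \<and>
      measure lebesgue (square c (3 * h) 0 \<inter> {x. (x \<in> \<Omega>) \<noteq> (d \<le> n \<bullet> (x - c))})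
        \<le> 108 * M * (2 + M)^3 * h powr (\<alpha> - 1) * measure lebesgue (square c h 0 \<inter> U)"
    if c: "norm (c - x\<^sub>0) \<le> R / 2" for c
  proof -
    let ?S = "square c (3 * h) 0"
    have near: "norm (x - c) \<le> 3 * h" if "x \<in> ?S" for x
      using norm_square_le[OF that] .
    have z_le: "\<bar>z1 x\<bar> \<le> R" "\<bar>z2 x\<bar> \<le> R" if "x \<in> ?S" for x
    proof -
      have "norm (x - x\<^sub>0) \<le> R"
        using norm_triangle_ineq[of "x - c" "c - x\<^sub>0"] near[OF that] c h by simp
      then show "\<bar>z1 x\<bar> \<le> R" "\<bar>z2 x\<bar> \<le> R"
        using inner_unit_le[OF e(1)] inner_unit_le[OF e(2)] unfolding z1_def z2_def
        by (meson order_trans)+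
    qed
    have mem: "x \<in> \<Omega> \<longleftrightarrow> z2 x \<le> \<psi> (z1 x)" if "x \<in> ?S" for x
      using graph[OF z_le[OF that]] unfolding expand .
    consider "?S \<inter> \<Omega> = {}" | "?S \<subseteq> \<Omega>" | y y' where "y \<in> ?S \<inter> \<Omega>" "y' \<in> ?S - \<Omega>"
      by blast
    then show ?thesis
    proof cases
      case 1
      have "e\<^sub>1 \<bullet> (x - c) < 4 * h" if "x \<in> ?S" for x
        using near[OF that] inner_unit_le[OF e(1), of "x - c"] h by (simp add: inner_commute)
      then have "?S \<inter> {x. (x \<in> \<Omega>) \<noteq> (4 * h \<le> e\<^sub>1 \<bullet> (x - c))} = {}"
        using 1 by (force simp: not_le)
      then show ?thesis
        using e(1) M by (intro exI[of _ e\<^sub>1] exI[of _ "4 * h"]) simp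
    next
      case 2
      have "- 4 * h \<le> e\<^sub>1 \<bullet> (x - c)" if "x \<in> ?S" for x
        using near[OF that] inner_unit_le[OF e(1), of "x - c"] h by (simp add: inner_commute)
      then have "?S \<inter> {x. (x \<in> \<Omega>) \<noteq> (- 4 * h \<le> e\<^sub>1 \<bullet> (x - c))} = {}"
        using 2 by force
      then show ?thesis
        using e(1) M by (intro exI[of _ e\<^sub>1] exI[of _ "- 4 * h"]) simp
    next
      case 3
      \<comment> \<open>signed height above the graph\<close>
      define G where "G x = z2 x - \<psi> (z1 x)" for x
      have G_close: "\<bar>G x - G y\<bar> \<le> \<epsilon>" if "x \<in> ?S" "y \<in> ?S" for x y
      proof -
        have "norm (x - y) \<le> 6 * h"
          using norm_triangle_ineq4[of "x - c" "y - c"] near[OF that(1)] near[OF that(2)] by simp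
        then have d: "\<bar>z1 x - z1 y\<bar> \<le> 6 * h" "\<bar>z2 x - z2 y\<bar> \<le> 6 * h"
          using inner_unit_le[OF e(1), of "x - y"] inner_unit_le[OF e(2), of "x - y"]
          by (auto simp: z1_def z2_def inner_diff_left)
        have "\<bar>\<psi> (z1 x) - \<psi> (z1 y)\<bar> \<le> M * \<bar>z1 x - z1 y\<bar>"
          using lip[of "z1 x" "z1 y"] z_le(1)[OF that(1)] z_le(1)[OF that(2)] by (auto simp: abs_le_iff)
        also have "\<dots> \<le> M * (6 * h)"
          using d M by (intro mult_left_mono) auto
        finally show ?thesis
          using d by (simp add: G_def \<epsilon>_def algebra_simps)
      qed
      have "square c h 0 \<subseteq> U"
      proof
        fix x assume "x \<in> square c h 0"
        then have "\<bar>x $ i - c $ i\<bar> \<le> h / 2" for i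
          by (simp add: mem_square)
        moreover have "h / 2 \<le> 3 * h / 2" using h by simp
        ultimately have "\<bar>x $ i - c $ i\<bar> \<le> 3 * h / 2" for i
          by (meson order_trans)
        then have x: "x \<in> ?S" by (simp add: mem_square)
        have "z2 y \<le> \<psi> (z1 y)" "\<not> z2 y' \<le> \<psi> (z1 y')"
          using 3 mem[of y] mem[of y'] by blast+
        then have "G y \<le> 0" "G y' > 0"
          unfolding G_def by linarith+
        moreover have "\<bar>G x - G y\<bar> \<le> \<epsilon>" "\<bar>G x - G y'\<bar> \<le> \<epsilon>"
          using G_close x 3 by blast+
        ultimately have "\<bar>G x\<bar> \<le> \<epsilon>" by linarith
        then show "x \<in> U"
          using inU[OF z_le(1)[OF x], of "z2 x"] unfolding expand G_def by blast
      qed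
      then have cU: "measure lebesgue (square c h 0 \<inter> U) = h\<^sup>2"
        using h by (simp add: Int_absorb2 measure_square)
      have "\<bar>z1 c\<bar> \<le> R"
        using z_le[of c] h by (simp add: mem_square)
      then obtain m where m: "\<bar>m\<bar> \<le> M"
        "\<And>z. z \<in> {-R..R} \<Longrightarrow> \<bar>\<psi> z - \<psi> (z1 c) - m * (z - z1 c)\<bar> \<le> M * \<bar>z - z1 c\<bar> powr \<alpha>"
        using approx[of "z1 c"] by (metis abs_le_iff atLeastAtMost_iff minus_le_iff)
      define g where "g z = \<psi> (z1 c) + m * (z - z1 c)" for z
      obtain n d where n: "norm n = 1"
        and "\<forall>x. d \<le> n \<bullet> (x - c) \<longleftrightarrow> (x - x\<^sub>0) \<bullet> e\<^sub>2 \<le> \<psi> (z1 c) + m * ((x - x\<^sub>0) \<bullet> e\<^sub>1 - z1 c)"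
        using half_plane_of_subgraph[OF e, of c x\<^sub>0 "\<psi> (z1 c)" m "z1 c"] by metis
      then have n2: "d \<le> n \<bullet> (x - c) \<longleftrightarrow> z2 x \<le> g (z1 x)" for x
        by (simp add: z1_def z2_def g_def)
      define \<delta> where "\<delta> = M * (3 * h) powr \<alpha>"
      have "\<delta> > 0" using M h by (simp add: \<delta>_def)
      have g_lip: "\<bar>g u - g v\<bar> \<le> M * \<bar>u - v\<bar>" for u v
        using m(1) by (simp add: g_def right_diff_distrib[symmetric] abs_mult mult_right_mono)
      have "\<exists>V\<in>lmeasurable. measure lebesgue V \<le> 4 * (2 + M)\<^sup>2 * (2 * (3 * h) + \<delta>) * \<delta> \<and>
        (\<forall>u v. \<bar>u - z1 c\<bar> \<le> 3 * h \<longrightarrow> \<bar>v - g u\<bar> \<le> \<delta> \<longrightarrow> x\<^sub>0 + u *\<^sub>R e\<^sub>1 + v *\<^sub>R e\<^sub>2 \<in> V)"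
        by (rule measure_lipschitz_strip) (use e g_lip h M \<open>\<delta> > 0\<close> in auto)
      then obtain V where V: "V \<in> lmeasurable" "measure lebesgue V \<le> 4 * (2 + M)\<^sup>2 * (2 * (3 * h) + \<delta>) * \<delta>"
        and inV: "\<And>u v. \<bar>u - z1 c\<bar> \<le> 3 * h \<Longrightarrow> \<bar>v - g u\<bar> \<le> \<delta> \<Longrightarrow> x\<^sub>0 + u *\<^sub>R e\<^sub>1 + v *\<^sub>R e\<^sub>2 \<in> V"
        by auto
      have "?S \<inter> {x. (x \<in> \<Omega>) \<noteq> (d \<le> n \<bullet> (x - c))} \<subseteq> V"
      proof
        fix x assume x: "x \<in> ?S \<inter> {x. (x \<in> \<Omega>) \<noteq> (d \<le> n \<bullet> (x - c))}"
        have z1c: "\<bar>z1 x - z1 c\<bar> \<le> 3 * h"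
          using near[of x] inner_unit_le[OF e(1), of "x - c"] x by (auto simp: z1_def inner_diff_left)
        have "\<bar>z2 x - g (z1 x)\<bar> \<le> \<bar>\<psi> (z1 x) - g (z1 x)\<bar>"
          using x mem[of x] n2[of x] by auto
        also have "\<dots> \<le> M * \<bar>z1 x - z1 c\<bar> powr \<alpha>"
        proof -
          have "z1 x \<in> {-R..R}"
            using z_le(1)[of x] x by (auto simp: abs_le_iff)
          then show ?thesis
            using m(2) by (simp add: g_def diff_diff_eq)
        qed
        also have "\<dots> \<le> \<delta>"
          unfolding \<delta>_def using M z1c \<alpha> by (intro mult_left_mono powr_mono2) auto
        finally show "x \<in> V"
          using inV[OF z1c, of "z2 x"] unfolding expand by blast
      qed
      moreover have "?S \<inter> {x. (x \<in> \<Omega>) \<noteq> (d \<le> n \<bullet> (x - c))} \<in> sets lebesgue"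
        using fmeasurableD[OF fmeasurable_Int_neq[OF \<Omega> sets_lebesgue_half_plane lmeasurable_square]] by simp
      ultimately have "measure lebesgue (?S \<inter> {x. (x \<in> \<Omega>) \<noteq> (d \<le> n \<bullet> (x - c))}) \<le> measure lebesgue V"
        using V(1) by (intro measure_mono_fmeasurable)
      also have "\<dots> \<le> 4 * (2 + M)\<^sup>2 * (2 * (3 * h) + \<delta>) * \<delta>" by (rule V(2))
      also have "\<dots> \<le> 4 * (2 + M)\<^sup>2 * (3 * (2 + M) * h) * (9 * M * h powr \<alpha>)"
      proof (intro mult_mono mult_left_mono)
        have "(3 * h) powr \<alpha> \<le> (3 * h) powr 1"
          using h R \<alpha> by (intro powr_mono') auto
        then have "\<delta> \<le> M * (3 * h)" unfolding \<delta>_def using M h by (intro mult_left_mono) auto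
        then show "2 * (3 * h) + \<delta> \<le> 3 * (2 + M) * h" by (simp add: algebra_simps)
        have "(3::real) powr \<alpha> \<le> 3 powr 2" using \<alpha> by (intro powr_mono) auto
        then have "3 powr \<alpha> * h powr \<alpha> \<le> 9 * h powr \<alpha>" by (intro mult_right_mono) auto
        then have "M * (3 powr \<alpha> * h powr \<alpha>) \<le> M * (9 * h powr \<alpha>)" using M by (intro mult_left_mono) auto
        then show "\<delta> \<le> 9 * M * h powr \<alpha>" using h by (simp add: \<delta>_def powr_mult mult_ac)
      qed (use M h \<open>\<delta> > 0\<close> in auto)
      also have "\<dots> = 108 * M * (2 + M)^3 * (h powr \<alpha> * h)"
        by (simp add: power2_eq_square power3_eq_cube)
      also have "h powr \<alpha> * h = h powr (\<alpha> - 1) * h\<^sup>2"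
        using h by (simp add: powr_diff power2_eq_square)
      finally show ?thesis
        using n unfolding cU by (intro exI[of _ n] exI[of _ d]) (simp add: mult_ac)
    qed
  qed
  then show ?thesis using U(1) U2 by blast
qed

section \<open>Grid cells and stencils\<close>

lemma cell_eq_square:
  assumes "h > 0"
  shows "cell h (k, l) = square (cell_center h (i, j)) h (vector [real k - real i, real l - real j])"
  by (simp add: square_def vec_eq_iff forall_2 algebra_simps)
    (intro arg_cong2[where f = cbox]; simp add: vec_eq_iff forall_2 algebra_simps)

lemma cell_eq_square_0: "cell h ij = square (cell_center h ij) h 0"
  by (cases ij) (simp add: square_def, intro arg_cong2[where f = cbox]; simp add: vec_eq_iff forall_2 algebra_simps)

lemma stencil_eq_square: "stencil h ij = square (cell_center h ij) (3 * h) 0"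
  by (cases ij) (simp add: square_def, intro arg_cong2[where f = cbox]; simp add: vec_eq_iff forall_2 algebra_simps)

lemma mem_cell:
  "x \<in> cell h (i, j) \<longleftrightarrow> (real i - 1) * h \<le> x $ 1 \<and> x $ 1 \<le> real i * h \<and> (real j - 1) * h \<le> x $ 2 \<and> x $ 2 \<le> real j * h"
  by (auto simp: mem_box_cart forall_2)

lemma mem_stencil:
  "x \<in> stencil h (i, j) \<longleftrightarrow> (real i - 2) * h \<le> x $ 1 \<and> x $ 1 \<le> (real i + 1) * h \<and> (real j - 2) * h \<le> x $ 2 \<and> x $ 2 \<le> (real j + 1) * h"
  by (auto simp: mem_box_cart forall_2)

lemma cell_subset_stencil_iff:
  assumes "h > 0"
  shows "cell h (k, l) \<subseteq> stencil h (i, j) \<longleftrightarrow> k \<in> {i - 1..i + 1} \<and> l \<in> {j - 1..j + 1}"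
proof
  assume sub: "cell h (k, l) \<subseteq> stencil h (i, j)"
  have "vector [(real k - 1) * h, (real l - 1) * h] \<in> cell h (k, l)" "vector [real k * h, real l * h] \<in> cell h (k, l)"
    using assms by (auto simp: mem_cell simp del: cell.simps)
  with sub have "vector [(real k - 1) * h, (real l - 1) * h] \<in> stencil h (i, j)" "vector [real k * h, real l * h] \<in> stencil h (i, j)"
    by auto
  then have "(real i - 2) * h \<le> (real k - 1) * h" "real k * h \<le> (real i + 1) * h"
      "(real j - 2) * h \<le> (real l - 1) * h" "real l * h \<le> (real j + 1) * h"
    by (auto simp: mem_stencil simp del: stencil.simps)
  then show "k \<in> {i - 1..i + 1} \<and> l \<in> {j - 1..j + 1}"
    using assms by auto
next
  assume kl: "k \<in> {i - 1..i + 1} \<and> l \<in> {j - 1..j + 1}"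
  then have "(real i - 2) * h \<le> (real k - 1) * h" "real k * h \<le> (real i + 1) * h"
      "(real j - 2) * h \<le> (real l - 1) * h" "real l * h \<le> (real j + 1) * h"
    using assms by (auto intro!: mult_right_mono)
  then show "cell h (k, l) \<subseteq> stencil h (i, j)"
    by (auto simp: mem_cell mem_stencil simp del: cell.simps stencil.simps)
qed

definition neighbours :: "nat \<Rightarrow> nat \<times> nat \<Rightarrow> (nat \<times> nat) set" where
  "neighbours L ij = {kl \<in> grid L. cell (1 / real L) kl \<subseteq> stencil (1 / real L) ij}"

lemma neighbours_inner:
  assumes "(i, j) \<in> inner_grid L"
  shows "neighbours L (i, j) = {i - 1..i + 1} \<times> {j - 1..j + 1}"
proof -
  have "L > 0" using assms by (auto simp: inner_grid_def)
  then have "kl \<in> neighbours L (i, j) \<longleftrightarrow> kl \<in> grid L \<and> kl \<in> {i - 1..i + 1} \<times> {j - 1..j + 1}" for kl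
    using cell_subset_stencil_iff[of "1 / real L" "fst kl" "snd kl" i j]
    by (simp add: neighbours_def mem_Times_iff del: cell.simps stencil.simps)
  then show ?thesis
    using assms by (auto simp: grid_def inner_grid_def)
qed

text \<open>This links sums over grid indices with sums over shifts, for which stability was stated.\<close>
lemma sum_neighbours:
  assumes ij: "ij \<in> inner_grid L"
  shows "(\<Sum>kl\<in>neighbours L ij. f (cell (1 / real L) kl)) = (\<Sum>t\<in>shifts. f (square (cell_center (1 / real L) ij) (1 / real L) t))"
proof -
  obtain i j where [simp]: "ij = (i, j)" by (cases ij)
  define h where "h = 1 / real L"
  have h: "h > 0" using ij by (auto simp: h_def inner_grid_def)
  have i: "i \<ge> 1" "j \<ge> 1" using ij by (auto simp: inner_grid_def)
  define g :: "nat \<times> nat \<Rightarrow> real^2" where "g = (\<lambda>(k, l). vector [real k - real i, real l - real j])"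
  have "bij_betw g ({i - 1..i + 1} \<times> {j - 1..j + 1}) shifts"
  proof (rule bij_betw_imageI)
    show "inj_on g ({i - 1..i + 1} \<times> {j - 1..j + 1})"
      by (auto simp: g_def inj_on_def vec_eq_iff forall_2)
    have one: "\<exists>k. k \<in> {m - 1..m + 1} \<and> real k - real m = r" if "r \<in> {-1, 0, 1}" "m \<ge> 1" for r and m :: nat
      by (rule exI[of _ "if r = -1 then m - 1 else if r = 0 then m else m + 1"]) (use that in auto)
    have "shifts \<subseteq> g ` ({i - 1..i + 1} \<times> {j - 1..j + 1})"
    proof
      fix t assume "t \<in> shifts"
      then obtain k l where "k \<in> {i - 1..i + 1}" "real k - real i = t $ 1" "l \<in> {j - 1..j + 1}" "real l - real j = t $ 2"
        using one[of "t $ 1" i] one[of "t $ 2" j] i unfolding shifts_def by blast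
      then show "t \<in> g ` ({i - 1..i + 1} \<times> {j - 1..j + 1})"
        by (intro image_eqI[of _ _ "(k, l)"]) (auto simp: g_def vec_eq_iff forall_2)
    qed
    have diff: "real k - real m = -1 \<or> real k - real m = 0 \<or> real k - real m = 1" if "k \<in> {m - 1..m + 1}" for k m :: nat
    proof -
      have "k = m - 1 \<and> m \<ge> 1 \<or> k = m \<or> k = m + 1" using that by auto
      then show ?thesis by auto
    qed
    have "g ` ({i - 1..i + 1} \<times> {j - 1..j + 1}) \<subseteq> shifts"
    proof (rule image_subsetI)
      fix kl assume "kl \<in> {i - 1..i + 1} \<times> {j - 1..j + 1}"
      then show "g kl \<in> shifts"
        using diff[of "fst kl" i] diff[of "snd kl" j]
        by (cases kl) (simp add: g_def shifts_def forall_2)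
    qed
    with \<open>shifts \<subseteq> _\<close> show "g ` ({i - 1..i + 1} \<times> {j - 1..j + 1}) = shifts"
      by blast
  qed
  then have "(\<Sum>t\<in>shifts. f (square (cell_center h ij) h t)) = (\<Sum>kl\<in>{i - 1..i + 1} \<times> {j - 1..j + 1}. f (square (cell_center h ij) h (g kl)))"
    by (rule sum.reindex_bij_betw[symmetric])
  also have "\<dots> = (\<Sum>kl\<in>{i - 1..i + 1} \<times> {j - 1..j + 1}. f (cell h kl))"
    using h by (intro sum.cong) (auto simp: g_def cell_eq_square[of h _ _ i j] simp del: cell.simps cell_center.simps)
  finally show ?thesis
    using ij by (simp add: neighbours_inner h_def del: cell.simps cell_center.simps)
qed

section \<open>The error of a local fit\<close>

lemma average_indicator:
  assumes "A \<in> sets lebesgue" "T \<in> lmeasurable"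
  shows "average T (indicator A) = measure lebesgue (T \<inter> A) / measure lebesgue T"
proof -
  have "set_lebesgue_integral lebesgue T (indicator A) = integral\<^sup>L lebesgue (indicator (T \<inter> A) :: _ \<Rightarrow> real)"
    unfolding set_lebesgue_integral_def by (rule arg_cong[where f = "integral\<^sup>L lebesgue"]) (auto simp: indicator_def)
  also have "\<dots> = measure lebesgue (T \<inter> A)"
    by simp
  finally show ?thesis by (simp add: average_def)
qed

lemma measure_Int_diff_le:
  assumes "A \<in> sets M" "B \<in> sets M" "T \<in> fmeasurable M"
  shows "\<bar>measure M (T \<inter> A) - measure M (T \<inter> B)\<bar> \<le> measure M (T \<inter> {x. (x \<in> A) \<noteq> (x \<in> B)})"
proof -
  have 1: "T \<inter> {x. (x \<in> A) \<noteq> (x \<in> B)} = T \<inter> ((A - B) \<union> (B - A))" by auto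
  have le: "measure M (T \<inter> A) \<le> measure M (T \<inter> B) + measure M (T \<inter> ((A - B) \<union> (B - A)))"
    if "A \<in> sets M" "B \<in> sets M" for A B
  proof -
    have "measure M (T \<inter> A) \<le> measure M ((T \<inter> B) \<union> (T \<inter> ((A - B) \<union> (B - A))))"
      using that assms(3) by (intro measure_mono_fmeasurable) (auto intro!: fmeasurable.Un fmeasurable_Int_fmeasurable dest: fmeasurableD)
    also have "\<dots> \<le> measure M (T \<inter> B) + measure M (T \<inter> ((A - B) \<union> (B - A)))"
      using that assms(3) by (intro measure_Un_le) (auto dest: fmeasurableD)
    finally show ?thesis .
  qed
  show ?thesis
    using le[OF assms(1,2)] le[OF assms(2,1)] unfolding 1 by (simp add: Un_commute abs_le_iff)
qed

text \<open>Let \<open>P\<close> be the competing half-plane, \<open>E\<close> the area in which it differs from \<open>\<Omega>\<close> on the stencil and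
  \<open>H\<close> the fitted half-plane. By minimality the averages of \<open>P\<close> and \<open>H\<close> are at \<open>\<ell>\<^sup>1\<close> distance at most twice
  that of the averages of \<open>P\<close> and the data, which is at most \<open>\<Sum> \<bar>\<eta>\<bar> + 9 E / h\<^sup>2\<close>. Stability doubles this
  once more and yields \<open>4 h\<^sup>2 \<Sum> \<bar>\<eta>\<bar> + 36 E\<close>; passing from \<open>P\<close> to \<open>\<Omega>\<close> costs another \<open>E\<close>.\<close>
lemma local_fit_error:
  fixes \<Omega> :: "(real^2) set" and n c :: "real^2"
  assumes ij: "ij \<in> inner_grid L" and \<Omega>: "\<Omega> \<in> sets lebesgue"
    and fit: "local_fit L (\<lambda>T. average (cell (1 / real L) T) (indicator \<Omega>) + \<eta> T) ij w"
    and n: "norm n = 1"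
  defines "h \<equiv> 1 / real L" and "c \<equiv> cell_center (1 / real L) ij"
  shows "\<exists>H. H \<in> sets lebesgue \<and> w = indicator H \<and>
    measure lebesgue (cell h ij \<inter> {x. (x \<in> \<Omega>) \<noteq> (x \<in> H)})
      \<le> 37 * measure lebesgue (stencil h ij \<inter> {x. (x \<in> \<Omega>) \<noteq> (d \<le> n \<bullet> (x - c))})
        + 4 * h\<^sup>2 * (\<Sum>kl\<in>neighbours L ij. \<bar>\<eta> kl\<bar>)"
proof -
  let ?N = "neighbours L ij"
  define P where "P = {x. d \<le> n \<bullet> (x - c)}"
  define a where "a A kl = average (cell h kl) (indicator A :: _ \<Rightarrow> real)" for A kl
  define z where "z kl = a \<Omega> kl + \<eta> kl" for kl
  have h: "h > 0" using ij by (auto simp: h_def inner_grid_def)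
  have min: "w \<in> half_planes c" "\<And>v. v \<in> half_planes c \<Longrightarrow>
      (\<Sum>kl\<in>?N. \<bar>z kl - average (cell h kl) w\<bar>) \<le> (\<Sum>kl\<in>?N. \<bar>z kl - average (cell h kl) v\<bar>)"
    using fit by (auto simp: local_fit_def Let_def is_arg_min_linorder neighbours_def z_def a_def h_def c_def
      simp del: cell.simps stencil.simps cell_center.simps)
  then obtain m e where w: "w = indicator {x. e \<le> m \<bullet> (x - c)}"
    by (auto simp: half_planes_def)
  define H where "H = {x. e \<le> m \<bullet> (x - c)}"
  have [measurable]: "P \<in> sets lebesgue" "H \<in> sets lebesgue"
    by (simp_all add: P_def H_def sets_lebesgue_half_plane)
  have cell_meas: "cell h kl \<in> lmeasurable" and cell_area: "measure lebesgue (cell h kl) = h\<^sup>2" for kl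
    using h by (simp_all add: cell_eq_square_0 measure_square del: cell.simps cell_center.simps)
  have st_meas: "stencil h ij \<in> lmeasurable"
    by (simp add: stencil_eq_square del: stencil.simps cell_center.simps)
  have a: "a A kl = measure lebesgue (cell h kl \<inter> A) / h\<^sup>2" if "A \<in> sets lebesgue" for A kl
    unfolding a_def by (simp add: average_indicator[OF that cell_meas] cell_area)
  define E where "E = measure lebesgue (stencil h ij \<inter> {x. (x \<in> \<Omega>) \<noteq> (x \<in> P)})"
  have "finite ?N" "card ?N \<le> 9"
  proof -
    obtain i j where ij': "ij = (i, j)" by (cases ij)
    show "finite ?N" "card ?N \<le> 9"
      using ij by (auto simp: ij' neighbours_inner card_cartesian_product inner_grid_def)
  qed
  have aE: "\<bar>a \<Omega> kl - a P kl\<bar> \<le> E / h\<^sup>2" if "kl \<in> ?N" for kl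
  proof -
    have "\<bar>a \<Omega> kl - a P kl\<bar> = \<bar>measure lebesgue (cell h kl \<inter> \<Omega>) - measure lebesgue (cell h kl \<inter> P)\<bar> / h\<^sup>2"
      using \<Omega> by (simp add: a diff_divide_distrib[symmetric])
    also have "\<dots> \<le> E / h\<^sup>2"
    proof (rule divide_right_mono)
      have "\<bar>measure lebesgue (cell h kl \<inter> \<Omega>) - measure lebesgue (cell h kl \<inter> P)\<bar>
          \<le> measure lebesgue (cell h kl \<inter> {x. (x \<in> \<Omega>) \<noteq> (x \<in> P)})"
        using \<Omega> cell_meas by (intro measure_Int_diff_le) auto
      also have "\<dots> \<le> E"
        unfolding E_def
      proof (rule measure_mono_fmeasurable)
        show "cell h kl \<inter> {x. (x \<in> \<Omega>) \<noteq> (x \<in> P)} \<subseteq> stencil h ij \<inter> {x. (x \<in> \<Omega>) \<noteq> (x \<in> P)}"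
          using that by (auto simp: neighbours_def h_def simp del: cell.simps stencil.simps)
      qed (use fmeasurable_Int_neq[OF \<Omega> \<open>P \<in> sets lebesgue\<close>] cell_meas st_meas in \<open>auto dest: fmeasurableD\<close>)
      finally show "\<bar>measure lebesgue (cell h kl \<inter> \<Omega>) - measure lebesgue (cell h kl \<inter> P)\<bar> \<le> E" .
    qed simp
    finally show ?thesis .
  qed
  have fitP: "(\<Sum>kl\<in>?N. \<bar>z kl - a H kl\<bar>) \<le> (\<Sum>kl\<in>?N. \<bar>z kl - a P kl\<bar>)"
    using min(2)[of "indicator P"] n unfolding a_def w H_def[symmetric]
    by (auto simp: half_planes_def P_def)
  have "(\<Sum>kl\<in>?N. \<bar>a P kl - a H kl\<bar>) \<le> (\<Sum>kl\<in>?N. \<bar>z kl - a P kl\<bar> + \<bar>z kl - a H kl\<bar>)"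
    by (intro sum_mono) auto
  also have "\<dots> \<le> 2 * (\<Sum>kl\<in>?N. \<bar>z kl - a P kl\<bar>)"
    using fitP by (simp add: sum.distrib)
  also have "\<dots> \<le> 2 * (\<Sum>kl\<in>?N. \<bar>\<eta> kl\<bar> + E / h\<^sup>2)"
  proof (intro mult_left_mono sum_mono)
    fix kl assume "kl \<in> ?N"
    then show "\<bar>z kl - a P kl\<bar> \<le> \<bar>\<eta> kl\<bar> + E / h\<^sup>2"
      using aE[of kl] by (simp add: z_def)
  qed simp
  also have "\<dots> = 2 * (\<Sum>kl\<in>?N. \<bar>\<eta> kl\<bar>) + 2 * (real (card ?N) * (E / h\<^sup>2))"
    by (simp add: sum.distrib)
  also have "\<dots> \<le> 2 * (\<Sum>kl\<in>?N. \<bar>\<eta> kl\<bar>) + 2 * (9 * (E / h\<^sup>2))"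
    using \<open>card ?N \<le> 9\<close> by (intro add_left_mono mult_left_mono mult_right_mono) (auto simp: E_def)
  finally have sum_a: "(\<Sum>kl\<in>?N. \<bar>a P kl - a H kl\<bar>) \<le> 2 * (\<Sum>kl\<in>?N. \<bar>\<eta> kl\<bar>) + 18 * (E / h\<^sup>2)"
    by simp
  have "measure lebesgue (cell h ij \<inter> {x. (x \<in> P) \<noteq> (x \<in> H)})
      \<le> 2 * (\<Sum>kl\<in>?N. \<bar>measure lebesgue (cell h kl \<inter> P) - measure lebesgue (cell h kl \<inter> H)\<bar>)"
    using half_plane_stability[OF h, of c "d + n \<bullet> c" n "e + m \<bullet> c" m]
    unfolding h_def c_def sum_neighbours[OF ij, of "\<lambda>T. \<bar>measure lebesgue (T \<inter> P) - measure lebesgue (T \<inter> H)\<bar>"]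
    by (simp add: cell_eq_square_0 P_def H_def c_def inner_diff_right le_diff_eq del: cell.simps cell_center.simps)
  also have "\<dots> = 2 * (h\<^sup>2 * (\<Sum>kl\<in>?N. \<bar>a P kl - a H kl\<bar>))"
    using h by (simp add: a diff_divide_distrib[symmetric] sum_divide_distrib[symmetric])
  also have "\<dots> \<le> 2 * (h\<^sup>2 * (2 * (\<Sum>kl\<in>?N. \<bar>\<eta> kl\<bar>) + 18 * (E / h\<^sup>2)))"
    using sum_a by (intro mult_left_mono) auto
  also have "\<dots> = 4 * h\<^sup>2 * (\<Sum>kl\<in>?N. \<bar>\<eta> kl\<bar>) + 36 * E"
    using h by (simp add: distrib_left)
  finally have PH: "measure lebesgue (cell h ij \<inter> {x. (x \<in> P) \<noteq> (x \<in> H)}) \<le> 4 * h\<^sup>2 * (\<Sum>kl\<in>?N. \<bar>\<eta> kl\<bar>) + 36 * E" .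
  note meas = fmeasurable_Int_neq[OF \<Omega> \<open>H \<in> sets lebesgue\<close> cell_meas[of ij]]
    fmeasurable_Int_neq[OF \<Omega> \<open>P \<in> sets lebesgue\<close> st_meas]
    fmeasurable_Int_neq[OF \<open>P \<in> sets lebesgue\<close> \<open>H \<in> sets lebesgue\<close> cell_meas[of ij]]
  have "measure lebesgue (cell h ij \<inter> {x. (x \<in> \<Omega>) \<noteq> (x \<in> H)})
      \<le> measure lebesgue ((stencil h ij \<inter> {x. (x \<in> \<Omega>) \<noteq> (x \<in> P)}) \<union> (cell h ij \<inter> {x. (x \<in> P) \<noteq> (x \<in> H)}))"
  proof (rule measure_mono_fmeasurable)
    have "cell h ij \<subseteq> stencil h ij"
      using h by (cases ij) (simp add: cell_subset_stencil_iff del: cell.simps stencil.simps)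
    then show "cell h ij \<inter> {x. (x \<in> \<Omega>) \<noteq> (x \<in> H)} \<subseteq>
        (stencil h ij \<inter> {x. (x \<in> \<Omega>) \<noteq> (x \<in> P)}) \<union> (cell h ij \<inter> {x. (x \<in> P) \<noteq> (x \<in> H)})"
      by auto
  qed (rule fmeasurableD[OF meas(1)], rule fmeasurable.Un[OF meas(2,3)])
  also have "\<dots> \<le> E + measure lebesgue (cell h ij \<inter> {x. (x \<in> P) \<noteq> (x \<in> H)})"
    unfolding E_def by (rule measure_Un_le[OF fmeasurableD[OF meas(2)] fmeasurableD[OF meas(3)]])
  finally show ?thesis
    using PH w \<open>H \<in> sets lebesgue\<close> by (intro exI[of _ H]) (auto simp: E_def P_def H_def)
qed

section \<open>Norms and powers\<close>

lemma recip_eq: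
  assumes "p \<ge> 1" "p \<noteq> \<infinity>"
  shows "enn2real p \<ge> 1" "recip p = 1 / enn2real p"
proof -
  obtain r where r: "p = ennreal r" "r \<ge> 0"
    using assms by (cases p) auto
  then have "r \<ge> 1"
    using assms(1) by (metis ennreal_1 ennreal_le_iff)
  have "1 / ennreal r = ennreal (1 / r)"
    using divide_ennreal[of 1 r] \<open>r \<ge> 1\<close> by simp
  with r \<open>r \<ge> 1\<close> show "enn2real p \<ge> 1" "recip p = 1 / enn2real p"
    by (simp_all add: recip_def)
qed

lemma recip_top [simp]: "recip top = 0"
  by (simp add: recip_def)

text \<open>Jensen's inequality for \<open>t powr p\<close>, applied to the nonzero terms; counting all terms instead only
  increases the factor in front.\<close>
lemma sum_abs_le_powr_sum:
  fixes x :: "'i \<Rightarrow> real"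
  assumes fin: "finite I" and p: "p \<ge> 1"
  shows "(\<Sum>i\<in>I. \<bar>x i\<bar>) \<le> real (card I) powr (1 - 1 / p) * (\<Sum>i\<in>I. \<bar>x i\<bar> powr p) powr (1 / p)"
proof -
  define J where "J = {i \<in> I. x i \<noteq> 0}"
  define m where "m = real (card J)"
  have J: "finite J" "J \<subseteq> I" using fin by (auto simp: J_def)
  have sums: "(\<Sum>i\<in>I. \<bar>x i\<bar>) = (\<Sum>i\<in>J. \<bar>x i\<bar>)" "(\<Sum>i\<in>I. \<bar>x i\<bar> powr p) = (\<Sum>i\<in>J. \<bar>x i\<bar> powr p)"
    using fin by (auto intro!: sum.mono_neutral_right simp: J_def)
  show ?thesis
  proof (cases "J = {}")
    case True
    then show ?thesis unfolding sums by simp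
  next
    case False
    then have m: "m > 0" using J by (simp add: m_def card_gt_0_iff)
    have "(\<Sum>i\<in>J. (1 / m) *\<^sub>R \<bar>x i\<bar>) powr p \<le> (\<Sum>i\<in>J. (1 / m) * \<bar>x i\<bar> powr p)"
      using J False m
      by (intro convex_on_sum[OF _ _ powr_convex[OF p]]) (auto simp: J_def m_def)
    then have "((\<Sum>i\<in>J. \<bar>x i\<bar>) / m) powr p \<le> (\<Sum>i\<in>J. \<bar>x i\<bar> powr p) / m"
      by (simp add: sum_divide_distrib)
    then have "(((\<Sum>i\<in>J. \<bar>x i\<bar>) / m) powr p) powr (1 / p) \<le> ((\<Sum>i\<in>J. \<bar>x i\<bar> powr p) / m) powr (1 / p)"
      using p by (intro powr_mono2) auto
    then have "(\<Sum>i\<in>J. \<bar>x i\<bar>) / m \<le> (\<Sum>i\<in>J. \<bar>x i\<bar> powr p) powr (1 / p) / m powr (1 / p)"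
      using p m by (simp add: powr_powr powr_divide sum_nonneg)
    then have "(\<Sum>i\<in>J. \<bar>x i\<bar>) \<le> m powr (1 - 1 / p) * (\<Sum>i\<in>J. \<bar>x i\<bar> powr p) powr (1 / p)"
      using m by (simp add: powr_diff field_simps)
    also have "\<dots> \<le> real (card I) powr (1 - 1 / p) * (\<Sum>i\<in>J. \<bar>x i\<bar> powr p) powr (1 / p)"
      unfolding m_def using p J fin by (intro mult_right_mono powr_mono2) (auto intro: card_mono)
    finally show ?thesis unfolding sums .
  qed
qed

lemma sum_abs_le_lp_norm:
  fixes x :: "'i \<Rightarrow> real"
  assumes I: "finite I" "I \<noteq> {}" and p: "p \<ge> 1"
  shows "(\<Sum>i\<in>I. \<bar>x i\<bar>) \<le> real (card I) powr (1 - recip p) * lp_norm I p x"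
proof (cases "p = \<infinity>")
  case True
  have "(\<Sum>i\<in>I. \<bar>x i\<bar>) \<le> (\<Sum>i\<in>I. Max ((\<lambda>i. \<bar>x i\<bar>) ` I))"
    using I by (intro sum_mono Max_ge) auto
  then show ?thesis using True I by (simp add: lp_norm_def)
next
  case False
  then show ?thesis
    using sum_abs_le_powr_sum[OF I(1) recip_eq(1)[OF p False], of x]
    by (simp add: lp_norm_def recip_eq(2)[OF p False])
qed

lemma lp_norm_nonneg: "finite I \<Longrightarrow> I \<noteq> {} \<Longrightarrow> lp_norm I p x \<ge> 0"
  by (auto simp: lp_norm_def Max_ge_iff)

lemma rpow_mono: "0 \<le> a \<Longrightarrow> a \<le> b \<Longrightarrow> 0 \<le> r \<Longrightarrow> rpow a r \<le> rpow b r"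
  by (auto simp: rpow_def powr_mono2)

text \<open>Both quotients \<open>t = a / (a + b)\<close> and \<open>t = b / (a + b)\<close> are at most 1 and hence at most \<open>t powr r\<close>.\<close>
lemma rpow_add_le:
  assumes "0 \<le> a" "0 \<le> b" "0 \<le> r" "r \<le> 1"
  shows "rpow (a + b) r \<le> rpow a r + rpow b r"
proof (cases "r = 0 \<or> a + b = 0")
  case True
  then show ?thesis using assms by (auto simp: rpow_def)
next
  case False
  then have pos: "a + b > 0" "r > 0" using assms by auto
  have "(a + b) powr r = (a / (a + b) + b / (a + b)) * (a + b) powr r"
    using pos by (simp add: add_divide_distrib[symmetric])
  also have "\<dots> \<le> ((a / (a + b)) powr r + (b / (a + b)) powr r) * (a + b) powr r"
  proof (intro mult_right_mono add_mono)
    have "t \<le> t powr r" if "0 \<le> t" "t \<le> 1" for t :: real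
      using powr_mono'[of r 1 t] that assms by simp
    then show "a / (a + b) \<le> (a / (a + b)) powr r" "b / (a + b) \<le> (b / (a + b)) powr r"
      using assms pos by auto
  qed simp
  also have "\<dots> = a powr r + b powr r"
    using assms pos by (simp add: powr_divide distrib_right)
  finally show ?thesis using pos by (simp add: rpow_def)
qed

lemma rpow_mult: "0 \<le> a \<Longrightarrow> 0 \<le> b \<Longrightarrow> rpow (a * b) r = rpow a r * rpow b r"
  by (simp add: rpow_def powr_mult)

section \<open>Domains with smooth boundary\<close>

definition smooth_domain :: "real \<Rightarrow> real \<Rightarrow> real \<Rightarrow> (real^2) set \<Rightarrow> bool" where
  "smooth_domain s R M \<Omega> \<longleftrightarrow>
     \<Omega> \<subseteq> rect R (1 - R) R (1 - R) \<and>
     (\<forall>x \<in> unit_square. \<exists>e\<^sub>1 e\<^sub>2 \<psi>.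
        norm e\<^sub>1 = 1 \<and> norm e\<^sub>2 = 1 \<and> e\<^sub>1 \<bullet> e\<^sub>2 = 0 \<and>
        \<psi> \<in> holder_space s {-R..R} \<and> holder_norm s {-R..R} \<psi> \<le> ennreal M \<and>
        (\<forall>z\<^sub>1 z\<^sub>2. \<bar>z\<^sub>1\<bar> \<le> R \<and> \<bar>z\<^sub>2\<bar> \<le> R \<longrightarrow>
           (x + z\<^sub>1 *\<^sub>R e\<^sub>1 + z\<^sub>2 *\<^sub>R e\<^sub>2 \<in> \<Omega> \<longleftrightarrow> z\<^sub>2 \<le> \<psi> z\<^sub>1)))"

lemma smooth_class_eq: "smooth_class s R M = {indicator \<Omega> | \<Omega>. smooth_domain s R M \<Omega>}"
  by (simp add: smooth_class_def smooth_domain_def)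

lemma smooth_domainE:
  assumes "smooth_domain s R M \<Omega>" "x \<in> unit_square"
  obtains e\<^sub>1 e\<^sub>2 \<psi> where "norm e\<^sub>1 = 1" "norm e\<^sub>2 = 1" "e\<^sub>1 \<bullet> e\<^sub>2 = 0"
    "\<psi> \<in> holder_space s {-R..R}" "holder_norm s {-R..R} \<psi> \<le> ennreal M"
    "\<And>z\<^sub>1 z\<^sub>2. \<bar>z\<^sub>1\<bar> \<le> R \<Longrightarrow> \<bar>z\<^sub>2\<bar> \<le> R \<Longrightarrow> (x + z\<^sub>1 *\<^sub>R e\<^sub>1 + z\<^sub>2 *\<^sub>R e\<^sub>2 \<in> \<Omega> \<longleftrightarrow> z\<^sub>2 \<le> \<psi> z\<^sub>1)"
proof -
  from assms obtain e\<^sub>1 e\<^sub>2 \<psi> where c: "norm e\<^sub>1 = 1 \<and> norm e\<^sub>2 = 1 \<and> e\<^sub>1 \<bullet> e\<^sub>2 = 0 \<and>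
      \<psi> \<in> holder_space s {-R..R} \<and> holder_norm s {-R..R} \<psi> \<le> ennreal M \<and>
      (\<forall>z\<^sub>1 z\<^sub>2. \<bar>z\<^sub>1\<bar> \<le> R \<and> \<bar>z\<^sub>2\<bar> \<le> R \<longrightarrow>
         (x + z\<^sub>1 *\<^sub>R e\<^sub>1 + z\<^sub>2 *\<^sub>R e\<^sub>2 \<in> \<Omega> \<longleftrightarrow> z\<^sub>2 \<le> \<psi> z\<^sub>1))"
    unfolding smooth_domain_def by meson
  show thesis
    by (rule that[of e\<^sub>1 e\<^sub>2 \<psi>]) (use c in blast)+
qed

lemma closed_subgraph_chart:
  fixes e\<^sub>1 e\<^sub>2 x\<^sub>0 :: "real^2"
  assumes e: "norm e\<^sub>1 = 1" "norm e\<^sub>2 = 1" "e\<^sub>1 \<bullet> e\<^sub>2 = 0"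
    and graph: "\<And>z\<^sub>1 z\<^sub>2. \<bar>z\<^sub>1\<bar> \<le> R \<Longrightarrow> \<bar>z\<^sub>2\<bar> \<le> R \<Longrightarrow> x\<^sub>0 + z\<^sub>1 *\<^sub>R e\<^sub>1 + z\<^sub>2 *\<^sub>R e\<^sub>2 \<in> \<Omega> \<longleftrightarrow> z\<^sub>2 \<le> \<psi> z\<^sub>1"
    and cont: "continuous_on {-R..R} \<psi>"
  shows "closed (\<Omega> \<inter> cball x\<^sub>0 R)"
proof -
  define z1 z2 where "z1 x = (x - x\<^sub>0) \<bullet> e\<^sub>1" and "z2 x = (x - x\<^sub>0) \<bullet> e\<^sub>2" for x
  have expand: "x\<^sub>0 + z1 x *\<^sub>R e\<^sub>1 + z2 x *\<^sub>R e\<^sub>2 = x" for x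
    using orthonormal_expansion[OF e, of "x - x\<^sub>0"] by (simp add: z1_def z2_def algebra_simps)
  have z_le: "\<bar>z1 x\<bar> \<le> R" "\<bar>z2 x\<bar> \<le> R" if "x \<in> cball x\<^sub>0 R" for x
    using that inner_unit_le[OF e(1), of "x - x\<^sub>0"] inner_unit_le[OF e(2), of "x - x\<^sub>0"]
    unfolding z1_def z2_def by (simp_all add: dist_norm norm_minus_commute)
  have mem: "x \<in> \<Omega> \<longleftrightarrow> z2 x \<le> \<psi> (z1 x)" if "x \<in> cball x\<^sub>0 R" for x
    using graph[OF z_le[OF that]] unfolding expand .
  have "continuous_on (cball x\<^sub>0 R) (\<lambda>x. \<psi> (z1 x))"
    by (rule continuous_on_compose2[OF cont])
      (use z_le in \<open>auto simp: z1_def abs_le_iff minus_le_iff intro!: continuous_intros\<close>)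
  then have "continuous_on (cball x\<^sub>0 R) (\<lambda>x. z2 x - \<psi> (z1 x))"
    unfolding z2_def by (intro continuous_intros)
  then have "closed (cball x\<^sub>0 R \<inter> (\<lambda>x. z2 x - \<psi> (z1 x)) -` {..0})"
    by (rule continuous_closed_preimage) auto
  also have "cball x\<^sub>0 R \<inter> (\<lambda>x. z2 x - \<psi> (z1 x)) -` {..0} = \<Omega> \<inter> cball x\<^sub>0 R"
    using mem by auto
  finally show ?thesis .
qed

lemma unit_square_net:
  assumes "e > 0"
  shows "\<exists>K. finite K \<and> K \<subseteq> unit_square \<and> unit_square \<subseteq> (\<Union>x\<in>K. ball x e)"
proof -
  have "compact unit_square" by (simp add: unit_square_def compact_cbox)
  moreover have "unit_square \<subseteq> (\<Union>x\<in>unit_square. ball x e)"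
    using assms by force
  ultimately obtain K where "K \<subseteq> unit_square" "finite K" "unit_square \<subseteq> (\<Union>x\<in>K. ball x e)"
    using compactE_image[of unit_square unit_square "\<lambda>x. ball x e"] by (metis open_ball)
  then show ?thesis by blast
qed

lemma smooth_domain_subset_unit_square:
  assumes "smooth_domain s R M \<Omega>" "0 < R"
  shows "\<Omega> \<subseteq> unit_square"
proof -
  have "rect R (1 - R) R (1 - R) \<subseteq> unit_square"
    using assms(2) by (auto simp: unit_square_def mem_box_cart forall_2)
  then show ?thesis
    using assms(1) by (auto simp: smooth_domain_def)
qed

text \<open>In each chart the domain is the part of a closed ball below a continuous graph. Finitely many
  charts cover the unit square, so the domain is even closed.\<close>
lemma smooth_domain_measurable:
  assumes \<Omega>: "smooth_domain s R M \<Omega>" and s: "s \<ge> 1" and R: "0 < R" and M: "M > 0"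
  shows "\<Omega> \<in> sets lebesgue"
proof -
  obtain K where K: "finite K" "K \<subseteq> unit_square" "unit_square \<subseteq> (\<Union>x\<in>K. ball x R)"
    using unit_square_net[OF R] by auto
  have "closed (\<Omega> \<inter> cball x R)" if "x \<in> K" for x
  proof -
    obtain e\<^sub>1 e\<^sub>2 \<psi> where chart: "norm e\<^sub>1 = 1" "norm e\<^sub>2 = 1" "e\<^sub>1 \<bullet> e\<^sub>2 = 0"
        "\<psi> \<in> holder_space s {-R..R}" "holder_norm s {-R..R} \<psi> \<le> ennreal M"
        "\<And>z\<^sub>1 z\<^sub>2. \<bar>z\<^sub>1\<bar> \<le> R \<Longrightarrow> \<bar>z\<^sub>2\<bar> \<le> R \<Longrightarrow> (x + z\<^sub>1 *\<^sub>R e\<^sub>1 + z\<^sub>2 *\<^sub>R e\<^sub>2 \<in> \<Omega> \<longleftrightarrow> z\<^sub>2 \<le> \<psi> z\<^sub>1)"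
      by (rule smooth_domainE[OF \<Omega> subsetD[OF K(2) \<open>x \<in> K\<close>]]) blast
    have "continuous_on {-R..R} \<psi>"
      using holder_lipschitz[OF s R M chart(4,5)] by (intro holder_imp_continuous_on[of 1 M]) (auto simp: M)
    then show ?thesis
      by (intro closed_subgraph_chart[OF chart(1-3,6)])
  qed
  then have "closed (\<Union>x\<in>K. \<Omega> \<inter> cball x R)"
    using K(1) by (intro closed_UN) auto
  also have "(\<Union>x\<in>K. \<Omega> \<inter> cball x R) = \<Omega>"
  proof -
    have "\<Omega> \<subseteq> (\<Union>x\<in>K. cball x R)"
      by (rule order_trans[OF order_trans[OF smooth_domain_subset_unit_square[OF \<Omega> R] K(3)]])
        (intro UN_mono order_refl ball_subset_cball)
    then show ?thesis by blast
  qed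
  finally show ?thesis
    using lebesgue_closedin[of UNIV \<Omega>] by simp
qed

section \<open>Summation over the cells\<close>

lemma mem_interior_cell:
  "x \<in> interior (cell h (i, j)) \<longleftrightarrow> (real i - 1) * h < x $ 1 \<and> x $ 1 < real i * h \<and> (real j - 1) * h < x $ 2 \<and> x $ 2 < real j * h"
  by (auto simp: mem_box_cart forall_2)

lemma lmeasurable_cell [simp]: "cell h ij \<in> lmeasurable"
  by (cases ij) simp

lemma measure_cell: "h \<ge> 0 \<Longrightarrow> measure lebesgue (cell h ij) = h\<^sup>2"
  by (simp add: cell_eq_square_0 measure_square del: cell.simps cell_center.simps)

lemma negligible_cell_Int:
  assumes "h > 0" "ij \<noteq> kl"
  shows "negligible (cell h ij \<inter> cell h kl)"
proof -
  obtain i j where ij: "ij = (i, j)" by (cases ij)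
  obtain k l where kl: "kl = (k, l)" by (cases kl)
  have idx: "a = b" if "(real a - 1) * h < t" "t < real a * h" "(real b - 1) * h < t" "t < real b * h" for a b :: nat and t
  proof -
    have "(real a - 1) * h < real b * h" "(real b - 1) * h < real a * h" using that by linarith+
    then have "real a - 1 < real b" "real b - 1 < real a"
      using assms(1) by (simp_all only: mult_less_cancel_right_pos)
    then show ?thesis by linarith
  qed
  have "interior (cell h ij \<inter> cell h kl) = {}"
    unfolding interior_Int
  proof (rule equals0I)
    fix x assume "x \<in> interior (cell h ij) \<inter> interior (cell h kl)"
    then have "i = k" "j = l"
      using idx[of i "x $ 1" k] idx[of j "x $ 2" l] unfolding ij kl Int_iff mem_interior_cell by blast+
    with assms(2) show False by (simp add: ij kl)
  qed
  moreover have "convex (cell h ij \<inter> cell h kl)"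
    unfolding ij kl by (simp add: convex_Int)
  ultimately show ?thesis
    using negligible_convex_interior by blast
qed

lemma finite_grid [simp]: "finite (grid L)" "finite (inner_grid L)"
  by (simp_all add: grid_def inner_grid_def)

lemma inner_grid_subset: "inner_grid L \<subseteq> grid L"
  by (auto simp: inner_grid_def grid_def)

lemma card_grid: "card (grid L) = L\<^sup>2"
  by (simp add: grid_def card_cartesian_product power2_eq_square)

lemma sum_measure_cells_le:
  assumes "h > 0" "finite G" "U \<in> lmeasurable"
  shows "(\<Sum>ij\<in>G. measure lebesgue (cell h ij \<inter> U)) \<le> measure lebesgue U"
proof -
  have m: "cell h ij \<inter> U \<in> lmeasurable" for ij
    using assms(3) by (intro fmeasurable.Int) auto
  have "(\<Sum>ij\<in>G. measure lebesgue (cell h ij \<inter> U)) = measure lebesgue (\<Union>ij\<in>G. cell h ij \<inter> U)"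
  proof (rule measure_negligible_finite_Union_image[symmetric])
    show "pairwise (\<lambda>ij kl. negligible ((cell h ij \<inter> U) \<inter> (cell h kl \<inter> U))) G"
      by (auto simp: pairwise_def intro: negligible_subset[OF negligible_cell_Int[OF assms(1)]] simp del: cell.simps)
  qed (use assms m in auto)
  also have "\<dots> \<le> measure lebesgue U"
    by (rule measure_mono_fmeasurable[OF _ fmeasurableD[OF fmeasurable.finite_UN[OF assms(2) m]] assms(3)]) auto
  finally show ?thesis .
qed

text \<open>Every cell belongs to the stencils of at most nine cells.\<close>
lemma sum_neighbours_le:
  fixes f :: "nat \<times> nat \<Rightarrow> real"
  assumes "\<And>kl. f kl \<ge> 0"
  shows "(\<Sum>ij\<in>inner_grid L. \<Sum>kl\<in>neighbours L ij. f kl) \<le> 9 * (\<Sum>kl\<in>grid L. f kl)"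
proof -
  have "(\<Sum>ij\<in>inner_grid L. \<Sum>kl\<in>neighbours L ij. f kl) = (\<Sum>ij\<in>inner_grid L. \<Sum>kl | kl \<in> grid L \<and> kl \<in> neighbours L ij. f kl)"
    by (intro sum.cong) (auto simp: neighbours_def simp del: cell.simps stencil.simps)
  also have "\<dots> = (\<Sum>kl\<in>grid L. \<Sum>ij | ij \<in> inner_grid L \<and> kl \<in> neighbours L ij. f kl)"
    by (rule sum.swap_restrict) auto
  also have "\<dots> \<le> (\<Sum>kl\<in>grid L. 9 * f kl)"
  proof (rule sum_mono)
    fix kl :: "nat \<times> nat"
    obtain k l where kl: "kl = (k, l)" by (cases kl)
    let ?A = "{ij. ij \<in> inner_grid L \<and> kl \<in> neighbours L ij}"
    have "?A \<subseteq> {k - 1..k + 1} \<times> {l - 1..l + 1}"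
      unfolding kl by (auto simp: neighbours_inner)
    then have "card ?A \<le> card ({k - 1..k + 1} \<times> {l - 1..l + 1})"
      by (intro card_mono) auto
    also have "\<dots> \<le> 3 * 3"
      unfolding card_cartesian_product by (intro mult_le_mono) auto
    finally have "real (card ?A) \<le> 9" by simp
    then show "(\<Sum>ij\<in>?A. f kl) \<le> 9 * f kl"
      using assms by (simp add: mult_right_mono)
  qed
  finally show ?thesis by (simp add: sum_distrib_left)
qed

lemma unit_square_subset_cells:
  assumes "L > 0"
  shows "unit_square \<subseteq> (\<Union>ij\<in>grid L. cell (1 / real L) ij)"
proof
  fix x assume x: "x \<in> unit_square"
  have ex: "\<exists>i\<in>{1..L}. (real i - 1) * (1 / real L) \<le> t \<and> t \<le> real i * (1 / real L)" if t: "0 \<le> t" "t \<le> 1" for t :: real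
  proof (cases "t = 0")
    case True
    then show ?thesis using assms by (intro bexI[of _ 1]) auto
  next
    case False
    define i where "i = nat \<lceil>t * real L\<rceil>"
    have "0 < t * real L" "t * real L \<le> real L" using t False assms by auto
    then have "i \<in> {1..L}" "real i - 1 \<le> t * real L" "t * real L \<le> real i"
      unfolding i_def by (auto simp: ceiling_le_iff) linarith+
    then show ?thesis using assms by (intro bexI[of _ i]) (auto simp: field_simps)
  qed
  have "0 \<le> x $ 1" "x $ 1 \<le> 1" "0 \<le> x $ 2" "x $ 2 \<le> 1"
    using x by (auto simp: unit_square_def mem_box_cart forall_2)
  then obtain i j where "i \<in> {1..L}" "j \<in> {1..L}"
    "(real i - 1) * (1 / real L) \<le> x $ 1" "x $ 1 \<le> real i * (1 / real L)"
    "(real j - 1) * (1 / real L) \<le> x $ 2" "x $ 2 \<le> real j * (1 / real L)"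
    using ex by meson
  then show "x \<in> (\<Union>ij\<in>grid L. cell (1 / real L) ij)"
    by (intro UN_I[of "(i, j)"]) (auto simp: grid_def mem_cell simp del: cell.simps)
qed

lemma cell_subset_unit_square:
  assumes "ij \<in> grid L"
  shows "cell (1 / real L) ij \<subseteq> unit_square"
proof -
  obtain i j where ij: "ij = (i, j)" by (cases ij)
  have i: "1 \<le> i" "i \<le> L" "1 \<le> j" "j \<le> L" using assms by (auto simp: ij grid_def)
  then have "0 \<le> (real i - 1) * (1 / real L)" "real i * (1 / real L) \<le> 1"
     "0 \<le> (real j - 1) * (1 / real L)" "real j * (1 / real L) \<le> 1"
    by (auto simp: field_simps)
  then show ?thesis
    unfolding ij by (auto simp: mem_cell unit_square_def mem_box_cart forall_2 simp del: cell.simps)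
qed

lemma smooth_domain_chart_approximation:
  assumes s: "s \<ge> 1" and R: "0 < R" "R < 1/2" and M: "M > 0"
    and \<Omega>: "smooth_domain s R M \<Omega>" and x\<^sub>0: "x\<^sub>0 \<in> unit_square" and h: "0 < h" "6 * h \<le> R"
  shows "\<exists>U\<in>lmeasurable. measure lebesgue U \<le> 24 * (2 + M)\<^sup>2 * (3 + M) * (1 + M) * h \<and>
    (\<forall>c. norm (c - x\<^sub>0) \<le> R / 2 \<longrightarrow> (\<exists>n d. norm n = 1 \<and>
      measure lebesgue (square c (3 * h) 0 \<inter> {x. (x \<in> \<Omega>) \<noteq> (d \<le> n \<bullet> (x - c))})
        \<le> 108 * M * (2 + M)^3 * h powr (min s 2 - 1) * measure lebesgue (square c h 0 \<inter> U)))"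
proof -
  obtain e\<^sub>1 e\<^sub>2 \<psi> where chart: "norm e\<^sub>1 = 1" "norm e\<^sub>2 = 1" "e\<^sub>1 \<bullet> e\<^sub>2 = 0"
      "\<psi> \<in> holder_space s {-R..R}" "holder_norm s {-R..R} \<psi> \<le> ennreal M"
      "\<And>z\<^sub>1 z\<^sub>2. \<bar>z\<^sub>1\<bar> \<le> R \<Longrightarrow> \<bar>z\<^sub>2\<bar> \<le> R \<Longrightarrow> (x\<^sub>0 + z\<^sub>1 *\<^sub>R e\<^sub>1 + z\<^sub>2 *\<^sub>R e\<^sub>2 \<in> \<Omega> \<longleftrightarrow> z\<^sub>2 \<le> \<psi> z\<^sub>1)"
    by (rule smooth_domainE[OF \<Omega> x\<^sub>0]) blast
  show ?thesis
    by (rule subgraph_local_approximation[where \<psi> = \<psi>, OF smooth_domain_measurable[OF \<Omega> s R(1) M] chart(1-3,6)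
          holder_lipschitz[OF s R(1) M chart(4,5)] holder_affine_approx[OF s R(1) M chart(4,5)]])
      (use s R M h in auto)
qed

text \<open>The net \<open>K\<close> of chart centres depends on \<open>R\<close> alone. For \<open>6 h \<le> R\<close> the stencil of a cell lies in the
  chart of any net point at distance at most \<open>R / 2\<close> from its centre, and the cells share the area of the
  neighbourhood \<open>U\<close> of that chart. For larger \<open>h\<close> the trivial bound 1 suffices, because then
  \<open>(6 / R)\<^sup>2 h\<^sup>\<alpha> \<ge> 1\<close>. The factor 36 combines the 4 of a single cell with the ninefold overlap of the
  stencils.\<close>
lemma smooth_domain_reconstruction_error:
  assumes s: "s \<ge> 1" and R: "0 < R" "R < 1/2" and M: "M > 0"
  shows "\<exists>C>0. \<forall>L \<Omega> \<eta> w. L > 0 \<longrightarrow> smooth_domain s R M \<Omega> \<longrightarrow>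
    (\<forall>ij\<in>inner_grid L. local_fit L (\<lambda>T. average (cell (1 / real L) T) (indicator \<Omega>) + \<eta> T) ij (w ij)) \<longrightarrow>
    (\<exists>H. (\<forall>ij\<in>inner_grid L. H ij \<in> sets lebesgue \<and> w ij = indicator (H ij)) \<and>
      (\<Sum>ij\<in>inner_grid L. measure lebesgue (cell (1 / real L) ij \<inter> {x. (x \<in> \<Omega>) \<noteq> (x \<in> H ij)}))
      \<le> C * (1 / real L) powr min s 2 + 36 * (1 / real L)\<^sup>2 * (\<Sum>kl\<in>grid L. \<bar>\<eta> kl\<bar>))"
proof -
  obtain K where K: "finite K" "K \<subseteq> unit_square" "unit_square \<subseteq> (\<Union>x\<in>K. ball x (R / 2))"
    using unit_square_net[of "R / 2"] R by auto
  define \<alpha> where "\<alpha> = min s 2"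
  define C\<^sub>U where "C\<^sub>U = 24 * (2 + M)\<^sup>2 * (3 + M) * (1 + M)"
  define A where "A = 108 * M * (2 + M)^3"
  define C where "C = (6 / R)\<^sup>2 + 37 * A * (real (card K) * C\<^sub>U)"
  have \<alpha>: "1 \<le> \<alpha>" "\<alpha> \<le> 2" using s by (auto simp: \<alpha>_def)
  have pos: "C\<^sub>U > 0" "A > 0" using M by (auto simp: C\<^sub>U_def A_def)
  then have "C > 0" using R by (auto simp: C_def intro!: add_pos_nonneg)
  have "\<exists>H. (\<forall>ij\<in>inner_grid L. H ij \<in> sets lebesgue \<and> w ij = indicator (H ij)) \<and>
      (\<Sum>ij\<in>inner_grid L. measure lebesgue (cell h ij \<inter> {x. (x \<in> \<Omega>) \<noteq> (x \<in> H ij)}))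
      \<le> C * h powr \<alpha> + 36 * h\<^sup>2 * (\<Sum>kl\<in>grid L. \<bar>\<eta> kl\<bar>)"
    if L: "L > 0" and \<Omega>: "smooth_domain s R M \<Omega>" and h_def: "h = 1 / real L"
      and fit: "\<And>ij. ij \<in> inner_grid L \<Longrightarrow> local_fit L (\<lambda>T. average (cell h T) (indicator \<Omega>) + \<eta> T) ij (w ij)"
    for L \<Omega> \<eta> w h
  proof -
    have h: "h > 0" using L by (simp add: h_def)
    have \<Omega>m: "\<Omega> \<in> sets lebesgue"
      by (rule smooth_domain_measurable[OF \<Omega> s R(1) M])
    have noise: "0 \<le> 36 * h\<^sup>2 * (\<Sum>kl\<in>grid L. \<bar>\<eta> kl\<bar>)"
      by (intro mult_nonneg_nonneg sum_nonneg) auto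
    show ?thesis
    proof (cases "6 * h \<le> R")
      case False
      have "\<exists>H. H \<in> sets lebesgue \<and> w ij = indicator H" if "ij \<in> inner_grid L" for ij
      proof -
        have "norm (axis 1 1 :: real^2) = 1" by (simp add: norm_axis_1)
        from local_fit_error[OF that \<Omega>m fit[OF that, unfolded h_def] this] show ?thesis by blast
      qed
      then obtain H where H: "\<And>ij. ij \<in> inner_grid L \<Longrightarrow> H ij \<in> sets lebesgue \<and> w ij = indicator (H ij)"
        by metis
      have "(\<Sum>ij\<in>inner_grid L. measure lebesgue (cell h ij \<inter> {x. (x \<in> \<Omega>) \<noteq> (x \<in> H ij)}))
          \<le> (\<Sum>ij\<in>inner_grid L. h\<^sup>2)"
      proof (rule sum_mono)
        fix ij assume "ij \<in> inner_grid L"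
        then have "cell h ij \<inter> {x. (x \<in> \<Omega>) \<noteq> (x \<in> H ij)} \<in> lmeasurable"
          using fmeasurable_Int_neq[OF \<Omega>m, of "H ij" "cell h ij"] H by simp
        then have "measure lebesgue (cell h ij \<inter> {x. (x \<in> \<Omega>) \<noteq> (x \<in> H ij)}) \<le> measure lebesgue (cell h ij)"
          by (intro measure_mono_fmeasurable) (auto dest: fmeasurableD simp del: cell.simps)
        then show "measure lebesgue (cell h ij \<inter> {x. (x \<in> \<Omega>) \<noteq> (x \<in> H ij)}) \<le> h\<^sup>2"
          using h by (simp add: measure_cell del: cell.simps)
      qed
      also have "\<dots> \<le> (\<Sum>ij\<in>grid L. h\<^sup>2)"
        by (rule sum_mono2) (auto simp: inner_grid_subset)
      also have "\<dots> = 1"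
        using L by (simp add: card_grid h_def field_simps)
      also have "1 \<le> (6 / R * h) powr \<alpha>"
        using False R \<alpha> by (intro ge_one_powr_ge_zero) (auto simp: field_simps)
      also have "\<dots> = (6 / R) powr \<alpha> * h powr \<alpha>"
        using R h by (subst powr_mult[symmetric]) auto
      also have "\<dots> \<le> (6 / R) powr 2 * h powr \<alpha>"
        using R \<alpha> by (intro mult_right_mono powr_mono) auto
      also have "\<dots> \<le> C * h powr \<alpha>"
        using R pos by (intro mult_right_mono) (auto simp: C_def)
      finally have le: "(\<Sum>ij\<in>inner_grid L. measure lebesgue (cell h ij \<inter> {x. (x \<in> \<Omega>) \<noteq> (x \<in> H ij)})) \<le> C * h powr \<alpha>" .
      show ?thesis
        by (intro exI[of _ H] conjI ballI order_trans[OF le]) (use H noise in simp_all)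
    next
      case True
      define good where "good x\<^sub>0 U \<longleftrightarrow> U \<in> lmeasurable \<and> measure lebesgue U \<le> C\<^sub>U * h \<and>
          (\<forall>c. norm (c - x\<^sub>0) \<le> R / 2 \<longrightarrow> (\<exists>n d. norm n = 1 \<and>
            measure lebesgue (square c (3 * h) 0 \<inter> {x. (x \<in> \<Omega>) \<noteq> (d \<le> n \<bullet> (x - c))})
              \<le> A * h powr (\<alpha> - 1) * measure lebesgue (square c h 0 \<inter> U)))" for x\<^sub>0 U
      have "\<exists>U. good x\<^sub>0 U" if "x\<^sub>0 \<in> K" for x\<^sub>0
        unfolding good_def C\<^sub>U_def A_def \<alpha>_def
        using smooth_domain_chart_approximation[OF s R M \<Omega> subsetD[OF K(2) that] h True] by (simp only: Bex_def)
      then obtain U where good: "\<And>x\<^sub>0. x\<^sub>0 \<in> K \<Longrightarrow> good x\<^sub>0 (U x\<^sub>0)"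
        by metis
      have U: "U x\<^sub>0 \<in> lmeasurable" "measure lebesgue (U x\<^sub>0) \<le> C\<^sub>U * h" if "x\<^sub>0 \<in> K" for x\<^sub>0
        using good[OF that] by (simp_all add: good_def)
      have approx: "\<exists>n d. norm n = 1 \<and>
            measure lebesgue (square c (3 * h) 0 \<inter> {x. (x \<in> \<Omega>) \<noteq> (d \<le> n \<bullet> (x - c))})
              \<le> A * h powr (\<alpha> - 1) * measure lebesgue (square c h 0 \<inter> U x\<^sub>0)"
        if "x\<^sub>0 \<in> K" "norm (c - x\<^sub>0) \<le> R / 2" for x\<^sub>0 c
        using good[OF that(1)] that(2) unfolding good_def by blast
      define fitted where "fitted ij H \<longleftrightarrow> H \<in> sets lebesgue \<and> w ij = indicator H \<and>
          measure lebesgue (cell h ij \<inter> {x. (x \<in> \<Omega>) \<noteq> (x \<in> H)})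
          \<le> 37 * (A * h powr (\<alpha> - 1) * (\<Sum>x\<^sub>0\<in>K. measure lebesgue (cell h ij \<inter> U x\<^sub>0)))
            + 4 * h\<^sup>2 * (\<Sum>kl\<in>neighbours L ij. \<bar>\<eta> kl\<bar>)" for ij H
      have "\<exists>H. fitted ij H" if ij: "ij \<in> inner_grid L" for ij
      proof -
        define c where "c = cell_center h ij"
        have "c \<in> cell h ij"
          using h by (simp add: cell_eq_square_0 c_def mem_square del: cell.simps cell_center.simps)
        then have "c \<in> unit_square"
          using cell_subset_unit_square[of ij L] ij inner_grid_subset by (auto simp: h_def simp del: cell.simps)
        then obtain x\<^sub>0 where x\<^sub>0: "x\<^sub>0 \<in> K" "norm (c - x\<^sub>0) \<le> R / 2"
          using K(3) by (force simp: dist_norm norm_minus_commute)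
        obtain n d where n: "norm n = 1"
          and nd: "measure lebesgue (stencil h ij \<inter> {x. (x \<in> \<Omega>) \<noteq> (d \<le> n \<bullet> (x - c))})
              \<le> A * h powr (\<alpha> - 1) * measure lebesgue (cell h ij \<inter> U x\<^sub>0)"
          using approx[OF x\<^sub>0] unfolding cell_eq_square_0 stencil_eq_square c_def by blast
        note nd
        also have "\<dots> \<le> A * h powr (\<alpha> - 1) * (\<Sum>x\<^sub>0\<in>K. measure lebesgue (cell h ij \<inter> U x\<^sub>0))"
          using pos x\<^sub>0(1) K(1) by (intro mult_left_mono member_le_sum) auto
        finally have le: "measure lebesgue (stencil h ij \<inter> {x. (x \<in> \<Omega>) \<noteq> (d \<le> n \<bullet> (x - c))})
          \<le> A * h powr (\<alpha> - 1) * (\<Sum>x\<^sub>0\<in>K. measure lebesgue (cell h ij \<inter> U x\<^sub>0))" .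
        obtain H where "H \<in> sets lebesgue" "w ij = indicator H"
          "measure lebesgue (cell h ij \<inter> {x. (x \<in> \<Omega>) \<noteq> (x \<in> H)})
           \<le> 37 * measure lebesgue (stencil h ij \<inter> {x. (x \<in> \<Omega>) \<noteq> (d \<le> n \<bullet> (x - c))})
            + 4 * h\<^sup>2 * (\<Sum>kl\<in>neighbours L ij. \<bar>\<eta> kl\<bar>)"
          using local_fit_error[OF ij \<Omega>m fit[OF ij, unfolded h_def] n, of d, folded h_def c_def] by blast
        then show ?thesis
          unfolding fitted_def using le by (intro exI[of _ H] conjI) (assumption | linarith)+
      qed
      then obtain H where fitted: "\<And>ij. ij \<in> inner_grid L \<Longrightarrow> fitted ij (H ij)"
        by metis
      have H: "H ij \<in> sets lebesgue \<and> w ij = indicator (H ij)"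
        and H_le: "measure lebesgue (cell h ij \<inter> {x. (x \<in> \<Omega>) \<noteq> (x \<in> H ij)})
          \<le> 37 * (A * h powr (\<alpha> - 1) * (\<Sum>x\<^sub>0\<in>K. measure lebesgue (cell h ij \<inter> U x\<^sub>0)))
            + 4 * h\<^sup>2 * (\<Sum>kl\<in>neighbours L ij. \<bar>\<eta> kl\<bar>)" if "ij \<in> inner_grid L" for ij
        using fitted[OF that] unfolding fitted_def by blast+
      have "(\<Sum>ij\<in>inner_grid L. \<Sum>x\<^sub>0\<in>K. measure lebesgue (cell h ij \<inter> U x\<^sub>0))
          = (\<Sum>x\<^sub>0\<in>K. \<Sum>ij\<in>inner_grid L. measure lebesgue (cell h ij \<inter> U x\<^sub>0))"
        by (rule sum.swap)
      also have "\<dots> \<le> (\<Sum>x\<^sub>0\<in>K. C\<^sub>U * h)"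
        by (intro sum_mono order_trans[OF sum_measure_cells_le[OF h finite_grid(2) U(1)] U(2)])
      finally have sumU: "(\<Sum>ij\<in>inner_grid L. \<Sum>x\<^sub>0\<in>K. measure lebesgue (cell h ij \<inter> U x\<^sub>0)) \<le> real (card K) * (C\<^sub>U * h)"
        by simp
      have "(\<Sum>ij\<in>inner_grid L. measure lebesgue (cell h ij \<inter> {x. (x \<in> \<Omega>) \<noteq> (x \<in> H ij)}))
          \<le> (\<Sum>ij\<in>inner_grid L. 37 * (A * h powr (\<alpha> - 1) * (\<Sum>x\<^sub>0\<in>K. measure lebesgue (cell h ij \<inter> U x\<^sub>0)))
            + 4 * h\<^sup>2 * (\<Sum>kl\<in>neighbours L ij. \<bar>\<eta> kl\<bar>))"
        by (intro sum_mono H_le)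
      also have "\<dots> = 37 * (A * h powr (\<alpha> - 1) * (\<Sum>ij\<in>inner_grid L. \<Sum>x\<^sub>0\<in>K. measure lebesgue (cell h ij \<inter> U x\<^sub>0)))
            + 4 * h\<^sup>2 * (\<Sum>ij\<in>inner_grid L. \<Sum>kl\<in>neighbours L ij. \<bar>\<eta> kl\<bar>)"
        by (simp only: sum.distrib sum_distrib_left)
      also have "\<dots> \<le> 37 * (A * h powr (\<alpha> - 1) * (real (card K) * (C\<^sub>U * h))) + 4 * h\<^sup>2 * (9 * (\<Sum>kl\<in>grid L. \<bar>\<eta> kl\<bar>))"
        using pos by (intro add_mono mult_left_mono sumU sum_neighbours_le) auto
      also have "\<dots> = 37 * A * (real (card K) * C\<^sub>U) * (h powr (\<alpha> - 1) * h) + 36 * h\<^sup>2 * (\<Sum>kl\<in>grid L. \<bar>\<eta> kl\<bar>)"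
        by simp
      also have "h powr (\<alpha> - 1) * h = h powr \<alpha>"
        using h by (simp add: powr_diff)
      finally have "(\<Sum>ij\<in>inner_grid L. measure lebesgue (cell h ij \<inter> {x. (x \<in> \<Omega>) \<noteq> (x \<in> H ij)}))
          \<le> 37 * A * (real (card K) * C\<^sub>U) * h powr \<alpha> + 36 * h\<^sup>2 * (\<Sum>kl\<in>grid L. \<bar>\<eta> kl\<bar>)" .
      moreover have "37 * A * (real (card K) * C\<^sub>U) * h powr \<alpha> \<le> C * h powr \<alpha>"
        by (intro mult_right_mono) (auto simp: C_def)
      ultimately have "(\<Sum>ij\<in>inner_grid L. measure lebesgue (cell h ij \<inter> {x. (x \<in> \<Omega>) \<noteq> (x \<in> H ij)}))
          \<le> C * h powr \<alpha> + 36 * h\<^sup>2 * (\<Sum>kl\<in>grid L. \<bar>\<eta> kl\<bar>)"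
        by linarith
      then show ?thesis
        using H by (intro exI[of _ H] conjI ballI) simp_all
    qed
  qed
  note reconstruct = this
  have main: "\<And>L \<Omega> \<eta> w. L > 0 \<Longrightarrow> smooth_domain s R M \<Omega> \<Longrightarrow>
      (\<And>ij. ij \<in> inner_grid L \<Longrightarrow> local_fit L (\<lambda>T. average (cell (1 / real L) T) (indicator \<Omega>) + \<eta> T) ij (w ij)) \<Longrightarrow>
      \<exists>H. (\<forall>ij\<in>inner_grid L. H ij \<in> sets lebesgue \<and> w ij = indicator (H ij)) \<and>
        (\<Sum>ij\<in>inner_grid L. measure lebesgue (cell (1 / real L) ij \<inter> {x. (x \<in> \<Omega>) \<noteq> (x \<in> H ij)}))
        \<le> C * (1 / real L) powr min s 2 + 36 * (1 / real L)\<^sup>2 * (\<Sum>kl\<in>grid L. \<bar>\<eta> kl\<bar>)"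
    by (rule reconstruct[unfolded \<alpha>_def, OF _ _ refl])
  show ?thesis
  proof (rule exI[of _ C], rule conjI[OF \<open>C > 0\<close>], intro allI impI)
    fix L :: nat and \<Omega> \<eta> w
    assume "L > 0" "smooth_domain s R M \<Omega>"
      and fit: "\<forall>ij\<in>inner_grid L. local_fit L (\<lambda>T. average (cell (1 / real L) T) (indicator \<Omega>) + \<eta> T) ij (w ij)"
    then show "\<exists>H. (\<forall>ij\<in>inner_grid L. H ij \<in> sets lebesgue \<and> w ij = indicator (H ij)) \<and>
        (\<Sum>ij\<in>inner_grid L. measure lebesgue (cell (1 / real L) ij \<inter> {x. (x \<in> \<Omega>) \<noteq> (x \<in> H ij)}))
        \<le> C * (1 / real L) powr min s 2 + 36 * (1 / real L)\<^sup>2 * (\<Sum>kl\<in>grid L. \<bar>\<eta> kl\<bar>)"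
      by (intro main[where \<eta> = \<eta> and w = w and L = L and \<Omega> = \<Omega>] bspec[OF fit])
  qed
qed

section \<open>The global error\<close>

lemma Lp_norm_sign_function:
  fixes f :: "'a \<Rightarrow> real"
  assumes meas: "f \<in> borel_measurable M" and sgn: "AE x in M. f x \<in> {-1, 0, 1}" and q: "q \<ge> 1"
    and b: "emeasure M {x \<in> space M. f x \<noteq> 0} \<le> ennreal b" "b \<ge> 0"
  shows "Lp_norm M q f \<le> ennreal (rpow b (recip q))"
proof (cases "q = \<infinity>")
  case True
  have "AE x in M. ennreal \<bar>f x\<bar> \<le> 1"
    using sgn by eventually_elim auto
  then have "esssup M (\<lambda>x. ennreal \<bar>f x\<bar>) \<le> 1"
    using meas by (intro esssup_I) auto
  then show ?thesis
    using meas True by (simp add: Lp_norm_def rpow_def)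
next
  case False
  note r = recip_eq[OF q False]
  define B where "B = {x \<in> space M. f x \<noteq> 0}"
  have "B \<in> sets M" using meas by (simp add: B_def)
  have "(\<integral>\<^sup>+ x. ennreal (\<bar>f x\<bar> powr enn2real q) \<partial>M) = (\<integral>\<^sup>+ x. indicator B x \<partial>M)"
  proof (rule nn_integral_cong_AE)
    show "AE x in M. ennreal (\<bar>f x\<bar> powr enn2real q) = indicator B x"
      using sgn AE_space by eventually_elim (auto simp: B_def indicator_def)
  qed
  also have "\<dots> = emeasure M B"
    using \<open>B \<in> sets M\<close> by simp
  finally have I: "(\<integral>\<^sup>+ x. ennreal (\<bar>f x\<bar> powr enn2real q) \<partial>M) = emeasure M B" .
  have "emeasure M B \<noteq> \<infinity>" "enn2real (emeasure M B) \<le> b"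
    using b by (auto simp: B_def top_unique enn2real_leI)
  then have "Lp_norm M q f = ennreal (enn2real (emeasure M B) powr recip q)"
    using meas False by (simp add: Lp_norm_def I)
  also have "\<dots> \<le> ennreal (b powr recip q)"
    using \<open>enn2real (emeasure M B) \<le> b\<close> r by (intro ennreal_leI powr_mono2) auto
  also have "b powr recip q = rpow b (recip q)"
    using r by (simp add: rpow_def)
  finally show ?thesis .
qed

text \<open>The values of the function on the complement of the open cells are irrelevant for Lebesgue
  measurability, because every subset of a null set is measurable.\<close>
lemma borel_measurable_on_cells:
  fixes f :: "real^2 \<Rightarrow> real"
  assumes cover: "finite G" "D \<in> sets lebesgue" "negligible (D - (\<Union>ij\<in>G. interior (T ij)))"
    and sub: "\<And>ij. ij \<in> G \<Longrightarrow> interior (T ij) \<subseteq> D"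
    and g: "\<And>ij. ij \<in> G \<Longrightarrow> g ij \<in> borel_measurable lebesgue"
    and eq: "\<And>ij x. ij \<in> G \<Longrightarrow> x \<in> interior (T ij) \<Longrightarrow> f x = g ij x"
  shows "f \<in> borel_measurable (lebesgue_on D)"
proof (rule measurableI)
  fix S :: "real set" assume S: "S \<in> sets borel"
  let ?N = "D - (\<Union>ij\<in>G. interior (T ij))"
  have pieces: "f -` S \<inter> D = (\<Union>ij\<in>G. g ij -` S \<inter> interior (T ij)) \<union> (f -` S \<inter> ?N)"
    using sub eq by auto
  have cell: "g ij -` S \<inter> interior (T ij) \<in> sets lebesgue" if "ij \<in> G" for ij
    using measurable_sets[OF g[OF that] S] by (simp add: sets.Int)
  have rest: "f -` S \<inter> ?N \<in> sets lebesgue"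
    using negligible_subset[OF cover(3), of "f -` S \<inter> ?N"] by (simp add: negligible_imp_sets)
  have "f -` S \<inter> D \<in> sets lebesgue"
    by (subst pieces, intro sets.Un sets.finite_UN cover(1) cell rest)
  then show "f -` S \<inter> space (lebesgue_on D) \<in> sets (lebesgue_on D)"
    using cover(2) by (simp add: sets_restrict_space_iff)
qed simp

text \<open>Boundary cells lie within distance \<open>h\<close> of the boundary of the square, but \<open>\<Omega>\<close> keeps the larger
  distance \<open>R\<close>.\<close>
lemma smooth_domain_disjoint_boundary_cell:
  assumes \<Omega>: "smooth_domain s R M \<Omega>" and h: "1 / real L < R" and ij: "ij \<in> grid L - inner_grid L"
  shows "interior (cell (1 / real L) ij) \<inter> \<Omega> = {}"
proof (rule equals0I)
  fix x assume x: "x \<in> interior (cell (1 / real L) ij) \<inter> \<Omega>"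
  obtain i j where ij': "ij = (i, j)" by (cases ij)
  have "x \<in> rect R (1 - R) R (1 - R)"
    using x \<Omega> by (auto simp: smooth_domain_def)
  then have R: "R \<le> x $ 1" "x $ 1 \<le> 1 - R" "R \<le> x $ 2" "x $ 2 \<le> 1 - R"
    by (auto simp: mem_box_cart forall_2)
  have c: "(real i - 1) * (1 / real L) < x $ 1" "x $ 1 < real i * (1 / real L)"
      "(real j - 1) * (1 / real L) < x $ 2" "x $ 2 < real j * (1 / real L)"
    using x unfolding ij' Int_iff mem_interior_cell by blast+
  have "L > 0" using ij by (auto simp: grid_def)
  then have last: "(real L - 1) * (1 / real L) = 1 - 1 / real L"
    by (simp add: field_simps)
  have "i = 1 \<or> i = L \<or> j = 1 \<or> j = L"
    using ij by (auto simp: ij' grid_def inner_grid_def)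
  then show False
  proof (elim disjE)
    assume "i = 1"
    then have "x $ 1 < 1 / real L" using c(2) by simp
    then show False using R h by linarith
  next
    assume "i = L"
    then have "1 - 1 / real L < x $ 1" using c(1) unfolding last[symmetric] by blast
    then show False using R h by linarith
  next
    assume "j = 1"
    then have "x $ 2 < 1 / real L" using c(4) by simp
    then show False using R h by linarith
  next
    assume "j = L"
    then have "1 - 1 / real L < x $ 2" using c(3) unfolding last[symmetric] by blast
    then show False using R h by linarith
  qed
qed

text \<open>The open cells exhaust the square up to a null set. On each of them \<open>f\<close> is the difference of two
  indicator functions, and on boundary cells it vanishes, so that only inner cells contribute.\<close>
lemma reconstruction_difference_on_cells:
  fixes \<Omega> :: "(real^2) set" and ut :: "real^2 \<Rightarrow> real"
  assumes h: "1 / real L < R" and \<Omega>: "smooth_domain s R M \<Omega>" "\<Omega> \<in> sets lebesgue"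
    and inner: "\<And>ij x. ij \<in> inner_grid L \<Longrightarrow> x \<in> interior (cell (1 / real L) ij) \<Longrightarrow> ut x = indicator (H ij) x"
    and boundary: "\<And>ij x. ij \<in> grid L - inner_grid L \<Longrightarrow> x \<in> interior (cell (1 / real L) ij) \<Longrightarrow> ut x = 0"
    and H: "\<And>ij. ij \<in> inner_grid L \<Longrightarrow> H ij \<in> sets lebesgue"
    and L: "L > 0"
  defines "f \<equiv> \<lambda>x. indicator \<Omega> x - ut x"
  shows "f \<in> borel_measurable (lebesgue_on unit_square)"
    and "AE x in lebesgue_on unit_square. f x \<in> {-1, 0, 1}"
    and "emeasure (lebesgue_on unit_square) {x \<in> space (lebesgue_on unit_square). f x \<noteq> 0} \<le>
      ennreal (\<Sum>ij\<in>inner_grid L. measure lebesgue (cell (1 / real L) ij \<inter> {x. (x \<in> \<Omega>) \<noteq> (x \<in> H ij)}))"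
proof -
  let ?D = unit_square
  define T where "T = cell (1 / real L)"
  define H' where "H' ij = (if ij \<in> inner_grid L then H ij else {})" for ij
  have H': "H' ij \<in> sets lebesgue" for ij
    using H by (simp add: H'_def)
  have eq: "f x = indicator \<Omega> x - indicator (H' ij) x" if "ij \<in> grid L" "x \<in> interior (T ij)" for ij x
    using that inner[of ij x] boundary[of ij x] by (cases "ij \<in> inner_grid L") (simp_all add: f_def H'_def T_def)
  let ?N = "?D - (\<Union>ij\<in>grid L. interior (T ij))"
  have D: "?D \<in> lmeasurable" by (simp add: unit_square_def)
  have N: "negligible ?N"
  proof (rule negligible_subset)
    show "negligible (\<Union>ij\<in>grid L. T ij - interior (T ij))"
    proof (rule negligible_Union)
      show "negligible S" if S: "S \<in> (\<lambda>ij. T ij - interior (T ij)) ` grid L" for S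
      proof -
        obtain i j where "S = T (i, j) - interior (T (i, j))" using S by auto
        then show ?thesis by (simp add: T_def negligible_frontier_interval)
      qed
    qed simp
    show "?N \<subseteq> (\<Union>ij\<in>grid L. T ij - interior (T ij))"
      using unit_square_subset_cells[OF L] unfolding T_def by blast
  qed
  have sub: "interior (T ij) \<subseteq> ?D" if "ij \<in> grid L" for ij
    using cell_subset_unit_square[OF that] interior_subset unfolding T_def by blast
  show meas: "f \<in> borel_measurable (lebesgue_on ?D)"
    by (rule borel_measurable_on_cells[where g = "\<lambda>ij x. indicator \<Omega> x - indicator (H' ij) x :: real",
          OF finite_grid(1) fmeasurableD[OF D] N])
      (use sub eq \<Omega>(2) H' in \<open>auto intro!: borel_measurable_diff borel_measurable_indicator\<close>)
  have "?N \<in> null_sets lebesgue"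
    using N negligible_iff_null_sets by blast
  then have "AE x in lebesgue. x \<notin> ?N"
    by (rule AE_not_in)
  then have AE_cell: "AE x in lebesgue_on ?D. x \<in> (\<Union>ij\<in>grid L. interior (T ij))"
  proof -
    have "?D \<inter> space lebesgue \<in> sets lebesgue"
      using D by (simp add: fmeasurableD)
    then show ?thesis
      using \<open>AE x in lebesgue. x \<notin> ?N\<close> by (simp only: AE_restrict_space_iff) (auto elim: eventually_mono)
  qed
  then show "AE x in lebesgue_on ?D. f x \<in> {-1, 0, 1}"
  proof eventually_elim
    case (elim x)
    then obtain ij where "ij \<in> grid L" "x \<in> interior (T ij)" by blast
    from eq[OF this] show ?case by (simp add: indicator_def)
  qed
  define B where "B = {x \<in> ?D. f x \<noteq> 0}"
  define E where "E ij = interior (T ij) \<inter> {x. (x \<in> \<Omega>) \<noteq> (x \<in> H' ij)}" for ij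
  have E: "E ij \<in> lmeasurable" for ij
    unfolding E_def by (rule fmeasurable_Int_neq[OF \<Omega>(2) H']) (cases ij, simp add: T_def)
  have B_eq: "B - ?N \<subseteq> (\<Union>ij\<in>grid L. E ij)"
    using eq unfolding B_def E_def by (force simp: indicator_def)
  have "B \<in> sets lebesgue"
    using measurable_sets[OF meas, of "- {0}"] fmeasurableD[OF D]
    by (simp add: sets_restrict_space_iff B_def vimage_def Int_def conj_commute)
  have "emeasure lebesgue B \<le> emeasure lebesgue ((\<Union>ij\<in>grid L. E ij) \<union> ?N)"
  proof (rule emeasure_mono)
    show "B \<subseteq> (\<Union>ij\<in>grid L. E ij) \<union> ?N" using B_eq by blast
    show "(\<Union>ij\<in>grid L. E ij) \<union> ?N \<in> sets lebesgue"
      using E N by (intro sets.Un sets.finite_UN) (auto dest: fmeasurableD simp: negligible_imp_sets)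
  qed
  also have "\<dots> = emeasure lebesgue (\<Union>ij\<in>grid L. E ij)"
    using E \<open>?N \<in> null_sets lebesgue\<close> by (intro emeasure_Un_null_set sets.finite_UN) (auto dest: fmeasurableD)
  also have "\<dots> = ennreal (measure lebesgue (\<Union>ij\<in>grid L. E ij))"
    using E by (intro emeasure_eq_measure2 fmeasurable.finite_UN) auto
  also have "\<dots> \<le> ennreal (\<Sum>ij\<in>grid L. measure lebesgue (E ij))"
    using E by (intro ennreal_leI measure_UNION_le) (auto dest: fmeasurableD)
  also have "(\<Sum>ij\<in>grid L. measure lebesgue (E ij)) = (\<Sum>ij\<in>inner_grid L. measure lebesgue (E ij))"
  proof (rule sum.mono_neutral_right)
    show "\<forall>ij\<in>grid L - inner_grid L. measure lebesgue (E ij) = 0"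
    proof
      fix ij assume ij: "ij \<in> grid L - inner_grid L"
      then have "E ij = interior (T ij) \<inter> \<Omega>" by (auto simp: E_def H'_def)
      also have "\<dots> = {}"
        unfolding T_def by (rule smooth_domain_disjoint_boundary_cell[OF \<Omega>(1) h ij])
      finally show "measure lebesgue (E ij) = 0" by simp
    qed
  qed (simp_all add: inner_grid_subset)
  also have "ennreal (\<Sum>ij\<in>inner_grid L. measure lebesgue (E ij)) \<le>
      ennreal (\<Sum>ij\<in>inner_grid L. measure lebesgue (T ij \<inter> {x. (x \<in> \<Omega>) \<noteq> (x \<in> H ij)}))"
  proof (intro ennreal_leI sum_mono measure_mono_fmeasurable)
    fix ij assume ij: "ij \<in> inner_grid L"
    show "E ij \<subseteq> T ij \<inter> {x. (x \<in> \<Omega>) \<noteq> (x \<in> H ij)}"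
      using ij interior_subset by (auto simp: E_def H'_def)
    show "T ij \<inter> {x. (x \<in> \<Omega>) \<noteq> (x \<in> H ij)} \<in> lmeasurable"
      unfolding T_def by (rule fmeasurable_Int_neq[OF \<Omega>(2) H[OF ij] lmeasurable_cell])
    show "E ij \<in> sets lebesgue" using E by (rule fmeasurableD)
  qed
  finally have "emeasure lebesgue B \<le> ennreal (\<Sum>ij\<in>inner_grid L. measure lebesgue (T ij \<inter> {x. (x \<in> \<Omega>) \<noteq> (x \<in> H ij)}))" .
  moreover have "emeasure (lebesgue_on ?D) B = emeasure lebesgue B"
    using D by (intro emeasure_restrict_space) (auto simp: B_def fmeasurableD)
  ultimately show "emeasure (lebesgue_on ?D) {x \<in> space (lebesgue_on ?D). f x \<noteq> 0} \<le>
      ennreal (\<Sum>ij\<in>inner_grid L. measure lebesgue (cell (1 / real L) ij \<inter> {x. (x \<in> \<Omega>) \<noteq> (x \<in> H ij)}))"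
    by (simp add: B_def T_def)
qed

text \<open>With \<open>r = 1/q\<close> the constants are \<open>C\<^sup>r\<close> and \<open>36\<^sup>r\<close>; the convention \<open>t\<^sup>0 = 1\<close> lets the case \<open>q = \<infinity>\<close>
  follow by the same computation.\<close>
theorem theorem5p4:
  fixes s R M :: real and p q :: ennreal
  assumes "s \<ge> 1" and "0 < R" and "R < 1/2" and "M > 0" and "p \<ge> 1" and "q \<ge> 1"
  shows "\<exists>C\<^sub>1 C\<^sub>2 :: real. C\<^sub>1 \<ge> 0 \<and> C\<^sub>2 \<ge> 0 \<and>
    (\<forall>(L::nat) (u :: real^2 \<Rightarrow> real) (\<eta> :: nat \<times> nat \<Rightarrow> real) (ut :: real^2 \<Rightarrow> real).
       L > 0 \<longrightarrow> 1 / real L < R \<longrightarrow> u \<in> smooth_class s R M \<longrightarrow>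
       is_reconstruction L (\<lambda>T. average (cell (1 / real L) T) u + \<eta> T) ut \<longrightarrow>
       (let n = real (L^2) in
        Lp_norm (lebesgue_on unit_square) q (\<lambda>x. u x - ut x)
          \<le> ennreal (C\<^sub>1 * n powr (- (min 1 (s / 2) * recip q)) +
                     C\<^sub>2 * n powr (- (recip p * recip q)) * rpow (lp_norm (grid L) p \<eta>) (recip q))))"
proof -
  obtain C where "C > 0" and C: "\<forall>L \<Omega> \<eta> w. L > 0 \<longrightarrow> smooth_domain s R M \<Omega> \<longrightarrow>
    (\<forall>ij\<in>inner_grid L. local_fit L (\<lambda>T. average (cell (1 / real L) T) (indicator \<Omega>) + \<eta> T) ij (w ij)) \<longrightarrow>
    (\<exists>H. (\<forall>ij\<in>inner_grid L. H ij \<in> sets lebesgue \<and> w ij = indicator (H ij)) \<and>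
      (\<Sum>ij\<in>inner_grid L. measure lebesgue (cell (1 / real L) ij \<inter> {x. (x \<in> \<Omega>) \<noteq> (x \<in> H ij)}))
      \<le> C * (1 / real L) powr min s 2 + 36 * (1 / real L)\<^sup>2 * (\<Sum>kl\<in>grid L. \<bar>\<eta> kl\<bar>))"
    using smooth_domain_reconstruction_error[OF assms(1-4)] by (elim exE conjE)
  define r where "r = recip q"
  have r: "0 \<le> r" "r \<le> 1"
    using recip_eq[OF assms(6)] by (cases "q = \<infinity>"; simp add: r_def)+
  have main: "Lp_norm (lebesgue_on unit_square) q (\<lambda>x. u x - ut x)
      \<le> ennreal (rpow C r * real (L^2) powr (- (min 1 (s / 2) * r)) +
          rpow 36 r * real (L^2) powr (- (recip p * r)) * rpow (lp_norm (grid L) p \<eta>) r)"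
    if L: "L > 0" and h: "1 / real L < R" and u: "u \<in> smooth_class s R M"
      and ut: "is_reconstruction L (\<lambda>T. average (cell (1 / real L) T) u + \<eta> T) ut" for L u \<eta> ut
  proof -
    define n where "n = real (L^2)"
    define e where "e = lp_norm (grid L) p \<eta>"
    have n: "n > 0" using L by (simp add: n_def)
    obtain \<Omega> where \<Omega>: "smooth_domain s R M \<Omega>" and u_eq: "u = indicator \<Omega>"
      using u unfolding smooth_class_eq by blast
    have \<Omega>m: "\<Omega> \<in> sets lebesgue"
      by (rule smooth_domain_measurable[OF \<Omega> assms(1,2,4)])
    obtain w where fit: "\<And>ij. ij \<in> inner_grid L \<Longrightarrow> local_fit L (\<lambda>T. average (cell (1 / real L) T) u + \<eta> T) ij (w ij)"
      and inner: "\<And>ij x. ij \<in> inner_grid L \<Longrightarrow> x \<in> interior (cell (1 / real L) ij) \<Longrightarrow> ut x = w ij x"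
      and boundary: "\<And>ij x. ij \<in> grid L - inner_grid L \<Longrightarrow> x \<in> interior (cell (1 / real L) ij) \<Longrightarrow> ut x = 0"
      using ut unfolding is_reconstruction_def by blast
    have "\<exists>H. (\<forall>ij\<in>inner_grid L. H ij \<in> sets lebesgue \<and> w ij = indicator (H ij)) \<and>
      (\<Sum>ij\<in>inner_grid L. measure lebesgue (cell (1 / real L) ij \<inter> {x. (x \<in> \<Omega>) \<noteq> (x \<in> H ij)}))
      \<le> C * (1 / real L) powr min s 2 + 36 * (1 / real L)\<^sup>2 * (\<Sum>kl\<in>grid L. \<bar>\<eta> kl\<bar>)"
      by (intro C[rule_format] L \<Omega>) (use fit u_eq in simp)
    then obtain H where H: "\<And>ij. ij \<in> inner_grid L \<Longrightarrow> H ij \<in> sets lebesgue"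
      and w: "\<And>ij. ij \<in> inner_grid L \<Longrightarrow> w ij = indicator (H ij)"
      and H_le: "(\<Sum>ij\<in>inner_grid L. measure lebesgue (cell (1 / real L) ij \<inter> {x. (x \<in> \<Omega>) \<noteq> (x \<in> H ij)}))
      \<le> C * (1 / real L) powr min s 2 + 36 * (1 / real L)\<^sup>2 * (\<Sum>kl\<in>grid L. \<bar>\<eta> kl\<bar>)" (is "?E \<le> _")
      by blast
    have e: "(\<Sum>kl\<in>grid L. \<bar>\<eta> kl\<bar>) \<le> n powr (1 - recip p) * e" "e \<ge> 0"
    proof -
      have "grid L \<noteq> {}" using L by (auto simp: grid_def)
      then show "(\<Sum>kl\<in>grid L. \<bar>\<eta> kl\<bar>) \<le> n powr (1 - recip p) * e" "e \<ge> 0"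
        using sum_abs_le_lp_norm[of "grid L" p \<eta>] assms(5) by (simp_all add: card_grid n_def e_def lp_norm_nonneg)
    qed
    have h2: "(1 / real L)\<^sup>2 = n powr - 1"
      using L by (simp add: n_def powr_minus_divide power_divide)
    have "?E \<le> C * (1 / real L) powr min s 2 + 36 * (1 / real L)\<^sup>2 * (n powr (1 - recip p) * e)"
      using e by (intro order_trans[OF H_le] add_left_mono mult_left_mono) auto
    also have "(1 / real L) powr min s 2 = n powr (- min 1 (s / 2))"
    proof -
      have "n = real L powr 2"
        using L by (simp add: n_def powr_numeral)
      then have "n powr (- min 1 (s / 2)) = real L powr (2 * - min 1 (s / 2))"
        by (simp only: powr_powr)
      also have "2 * - min 1 (s / 2) = - min s 2"
        by (simp add: min_def)
      finally show ?thesis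
        using L by (simp add: powr_divide powr_minus_divide)
    qed
    also have "36 * (1 / real L)\<^sup>2 * (n powr (1 - recip p) * e) = 36 * n powr (- recip p) * e"
      unfolding h2 using n by (simp add: powr_diff powr_minus_divide)
    finally have E: "?E \<le> C * n powr (- min 1 (s / 2)) + 36 * n powr (- recip p) * e" .
    have E0: "0 \<le> ?E" by (intro sum_nonneg) simp
    have "ut x = indicator (H ij) x" if "ij \<in> inner_grid L" "x \<in> interior (cell (1 / real L) ij)" for ij x
      using inner[OF that] w[OF that(1)] by simp
    note cells = reconstruction_difference_on_cells[OF h \<Omega> \<Omega>m this boundary H L]
    have "Lp_norm (lebesgue_on unit_square) q (\<lambda>x. u x - ut x) \<le> ennreal (rpow ?E r)"
      unfolding u_eq r_def
      by (rule Lp_norm_sign_function[OF cells(1) cells(2) assms(6) cells(3) E0])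
    also have "\<dots> \<le> ennreal (rpow (C * n powr (- min 1 (s / 2)) + 36 * n powr (- recip p) * e) r)"
      by (intro ennreal_leI rpow_mono E E0 r)
    also have "\<dots> \<le> ennreal (rpow (C * n powr (- min 1 (s / 2))) r + rpow (36 * n powr (- recip p) * e) r)"
      using \<open>C > 0\<close> e r by (intro ennreal_leI rpow_add_le) auto
    also have "rpow (C * n powr (- min 1 (s / 2))) r = rpow C r * n powr (- (min 1 (s / 2) * r))"
      using \<open>C > 0\<close> n by (simp add: rpow_mult) (simp add: rpow_def powr_powr)
    also have "rpow (36 * n powr (- recip p) * e) r = rpow 36 r * n powr (- (recip p * r)) * rpow e r"
      using n e by (simp add: rpow_mult) (simp add: rpow_def powr_powr)
    finally show ?thesis
      unfolding n_def e_def .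
  qed
  show ?thesis
    unfolding Let_def r_def[symmetric]
  proof (rule exI[of _ "rpow C r"], rule exI[of _ "rpow 36 r"], intro conjI allI impI)
    show "0 \<le> rpow C r" "0 \<le> rpow 36 r" by (simp_all add: rpow_def)
  qed (rule main)
qed

end
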